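(* Let $G$ be a second-countable locally compact Hausdorff étale groupoid, and suppose $G$ has polynomial growth. Then $G$ is topologically amenable.
   Context: $G$ is a topological groupoid with unit space $G^{(0)}$, range and source maps $r,s\colon G\to G^{(0)}$, and fibres $G^x=r^{-1}(x)$, $G_x=s^{-1}(x)$ for $x\in G^{(0)}$. A locally compact Hausdorff groupoid is étale if $r$ (equivalently $s$) is a local homeomorphism onto $G^{(0)}$. $G^{(2)}$ denotes the set of composable pairs. Length functions. A length function on $G$ is a function $\ell\colon G\to[0,\infty)$ (not assumed continuous) such that (1) $\ell(\gamma)=0$ for all $\gamma\in G^{(0)}$; (2) $\ell(\gamma^{-1})=\ell(\gamma)$ for all $\gamma\in G$; (3) $\ell(\gamma\mu)\le\ell(\gamma)+\ell(\mu)$ for all $(\gamma,\mu)\in G^{(2)}$. Put $B_\ell(t)=\{\gamma\in G:\ell(\gamma)\le t\}$ and $B_\ell(t)x=\{\gamma\in B_\ell(t): s(\gamma)=x\}$ for $t\ge0$, $x\in G^{(0)}$. $\ell$ is controlled if $\sup_{\gamma\in K}\ell(\gamma)<\infty$ for all precompact $K\subseteq G$ (i.e. with compact closure); uniformly fibrewise proper if $\sup_{x\in G^{(0)}}|B_\ell(t)x|<\infty$ for all $t\ge 0$; and uniformly fibrewise coarse if it is both. Polynomial growth. The growth function of a uniformly fibrewise coarse length function $\ell$ is $\gamma_\ell\colon[0,\infty)\to[0,\infty)$, $\gamma_\ell(t)=\sup_{x\in G^{(0)}}|B_\ell(t)x|$. $G$ has polynomial growth if there exist a uniformly fibrewise coarse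 length function $\ell$ on $G$ and a real polynomial $p$ with $\gamma_\ell(t)\le p(t)$ for all $t\in[0,\infty)$. Topological amenability. $G$ is topologically amenable if there is a sequence $(g_n)_n$ of non-negative continuous functions on $G$ such that (1) $\sum_{\gamma\in G^x}g_n(\gamma)\le1$ for all $x\in G^{(0)}$ and all $n$; (2) $\sum_{\gamma\in G^x}g_n(\gamma)\to1$ uniformly for $x$ in every compact subset of $G^{(0)}$; (3) $\sum_{\gamma\in G^{r(\mu)}}|g_n(\mu^{-1}\gamma)-g_n(\gamma)|\to0$ uniformly for $\mu$ in every compact subset of $G$. *)

theory Defs
  imports "HOL-Analysis.Analysis" "HOL-Computational_Algebra.Polynomial"
begin

text \<open>
  A groupoid is given by the topological space of its arrows, whose \<open>topspace\<close> is the set of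
  arrows, together with its structure maps. All maps are total functions on the ambient type and
  matter only on arrows; the composite \<open>comp G \<gamma> \<mu>\<close> matters only when the source of \<open>\<gamma>\<close> is the
  range of \<open>\<mu>\<close>. Units are particular arrows, and the unit space carries the subspace topology.
\<close>

record 'a groupoid =
  arrow_space :: "'a topology"
  units :: "'a set"
  rng :: "'a \<Rightarrow> 'a"
  src :: "'a \<Rightarrow> 'a"
  comp :: "'a \<Rightarrow> 'a \<Rightarrow> 'a"
  ginv :: "'a \<Rightarrow> 'a"

abbreviation arrows :: "('a, 'b) groupoid_scheme \<Rightarrow> 'a set" where
  "arrows G \<equiv> topspace (arrow_space G)"

definition unit_space :: "('a, 'b) groupoid_scheme \<Rightarrow> 'a topology" where
  "unit_space G = subtopology (arrow_space G) (units G)"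

definition range_fibre :: "('a, 'b) groupoid_scheme \<Rightarrow> 'a \<Rightarrow> 'a set" where
  "range_fibre G x = {\<gamma> \<in> arrows G. rng G \<gamma> = x}"

definition composable_pairs :: "('a, 'b) groupoid_scheme \<Rightarrow> ('a \<times> 'a) set" where
  "composable_pairs G = {(\<gamma>, \<mu>). \<gamma> \<in> arrows G \<and> \<mu> \<in> arrows G \<and> src G \<gamma> = rng G \<mu>}"

locale groupoid =
  fixes G :: "('a, 'b) groupoid_scheme"
  assumes units_subset: "units G \<subseteq> arrows G"
    and rng_closed: "\<gamma> \<in> arrows G \<Longrightarrow> rng G \<gamma> \<in> units G"
    and src_closed: "\<gamma> \<in> arrows G \<Longrightarrow> src G \<gamma> \<in> units G"
    and rng_unit: "x \<in> units G \<Longrightarrow> rng G x = x"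
    and src_unit: "x \<in> units G \<Longrightarrow> src G x = x"
    and comp_closed: "(\<gamma>, \<mu>) \<in> composable_pairs G \<Longrightarrow> comp G \<gamma> \<mu> \<in> arrows G"
    and rng_comp: "(\<gamma>, \<mu>) \<in> composable_pairs G \<Longrightarrow> rng G (comp G \<gamma> \<mu>) = rng G \<gamma>"
    and src_comp: "(\<gamma>, \<mu>) \<in> composable_pairs G \<Longrightarrow> src G (comp G \<gamma> \<mu>) = src G \<mu>"
    and comp_assoc: "\<lbrakk>(\<gamma>, \<mu>) \<in> composable_pairs G; (\<mu>, \<nu>) \<in> composable_pairs G\<rbrakk>
          \<Longrightarrow> comp G (comp G \<gamma> \<mu>) \<nu> = comp G \<gamma> (comp G \<mu> \<nu>)"
    and comp_rng_left: "\<gamma> \<in> arrows G \<Longrightarrow> comp G (rng G \<gamma>) \<gamma> = \<gamma>"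
    and comp_src_right: "\<gamma> \<in> arrows G \<Longrightarrow> comp G \<gamma> (src G \<gamma>) = \<gamma>"
    and ginv_closed: "\<gamma> \<in> arrows G \<Longrightarrow> ginv G \<gamma> \<in> arrows G"
    and rng_ginv: "\<gamma> \<in> arrows G \<Longrightarrow> rng G (ginv G \<gamma>) = src G \<gamma>"
    and src_ginv: "\<gamma> \<in> arrows G \<Longrightarrow> src G (ginv G \<gamma>) = rng G \<gamma>"
    and comp_ginv_right: "\<gamma> \<in> arrows G \<Longrightarrow> comp G \<gamma> (ginv G \<gamma>) = rng G \<gamma>"
    and comp_ginv_left: "\<gamma> \<in> arrows G \<Longrightarrow> comp G (ginv G \<gamma>) \<gamma> = src G \<gamma>"

text \<open>
  Continuity of the range and source maps follows from
  \<open>rng G \<gamma> = comp G \<gamma> (ginv G \<gamma>)\<close> and \<open>src G \<gamma> = comp G (ginv G \<gamma>) \<gamma>\<close>.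
\<close>

locale topological_groupoid = groupoid +
  assumes continuous_comp: "continuous_map
      (subtopology (prod_topology (arrow_space G) (arrow_space G)) (composable_pairs G))
      (arrow_space G) (\<lambda>(\<gamma>, \<mu>). comp G \<gamma> \<mu>)"
    and continuous_ginv: "continuous_map (arrow_space G) (arrow_space G) (ginv G)"

definition local_homeomorphism_map :: "'a topology \<Rightarrow> 'b topology \<Rightarrow> ('a \<Rightarrow> 'b) \<Rightarrow> bool" where
  "local_homeomorphism_map X Y f \<longleftrightarrow>
     (\<forall>x \<in> topspace X. \<exists>V. openin X V \<and> x \<in> V \<and> openin Y (f ` V) \<and>
        homeomorphic_map (subtopology X V) (subtopology Y (f ` V)) f)"

locale lch_etale_groupoid = topological_groupoid +
  assumes locally_compact: "locally_compact_space (arrow_space G)"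
    and Hausdorff: "Hausdorff_space (arrow_space G)"
    and etale: "local_homeomorphism_map (arrow_space G) (unit_space G) (rng G)"

definition length_function :: "('a, 'b) groupoid_scheme \<Rightarrow> ('a \<Rightarrow> real) \<Rightarrow> bool" where
  "length_function G l \<longleftrightarrow>
     (\<forall>\<gamma> \<in> arrows G. 0 \<le> l \<gamma>) \<and>
     (\<forall>\<gamma> \<in> units G. l \<gamma> = 0) \<and>
     (\<forall>\<gamma> \<in> arrows G. l (ginv G \<gamma>) = l \<gamma>) \<and>
     (\<forall>(\<gamma>, \<mu>) \<in> composable_pairs G. l (comp G \<gamma> \<mu>) \<le> l \<gamma> + l \<mu>)"

definition length_ball :: "('a, 'b) groupoid_scheme \<Rightarrow> ('a \<Rightarrow> real) \<Rightarrow> real \<Rightarrow> 'a set" where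
  "length_ball G l t = {\<gamma> \<in> arrows G. l \<gamma> \<le> t}"

definition fibre_ball :: "('a, 'b) groupoid_scheme \<Rightarrow> ('a \<Rightarrow> real) \<Rightarrow> real \<Rightarrow> 'a \<Rightarrow> 'a set" where
  "fibre_ball G l t x = {\<gamma> \<in> length_ball G l t. src G \<gamma> = x}"

definition controlled :: "('a, 'b) groupoid_scheme \<Rightarrow> ('a \<Rightarrow> real) \<Rightarrow> bool" where
  "controlled G l \<longleftrightarrow>
     (\<forall>K \<subseteq> arrows G. compactin (arrow_space G) (arrow_space G closure_of K) \<longrightarrow> bdd_above (l ` K))"

definition uniformly_fibrewise_proper :: "('a, 'b) groupoid_scheme \<Rightarrow> ('a \<Rightarrow> real) \<Rightarrow> bool" where
  "uniformly_fibrewise_proper G l \<longleftrightarrow>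
     (\<forall>t \<ge> 0. (\<forall>x \<in> units G. finite (fibre_ball G l t x)) \<and>
              bdd_above ((\<lambda>x. card (fibre_ball G l t x)) ` units G))"

definition uniformly_fibrewise_coarse :: "('a, 'b) groupoid_scheme \<Rightarrow> ('a \<Rightarrow> real) \<Rightarrow> bool" where
  "uniformly_fibrewise_coarse G l \<longleftrightarrow>
     length_function G l \<and> controlled G l \<and> uniformly_fibrewise_proper G l"

text \<open>
  The supremum is taken in \<^typ>\<open>nat\<close>, where the supremum of the empty set is \<open>0\<close>, so that the empty
  groupoid has growth function \<open>0\<close>. The value is meaningful only for uniformly fibrewise proper
  \<open>l\<close> and \<open>t \<ge> 0\<close>.
\<close>

definition growth_function :: "('a, 'b) groupoid_scheme \<Rightarrow> ('a \<Rightarrow> real) \<Rightarrow> real \<Rightarrow> real" where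
  "growth_function G l t = real (SUP x \<in> units G. card (fibre_ball G l t x))"

definition polynomial_growth :: "('a, 'b) groupoid_scheme \<Rightarrow> bool" where
  "polynomial_growth G \<longleftrightarrow>
     (\<exists>l (p :: real poly). uniformly_fibrewise_coarse G l \<and>
        (\<forall>t \<ge> 0. growth_function G l t \<le> poly p t))"

text \<open>
  Since \<open>infsum\<close> is \<open>0\<close> for non-summable families, a bound on a sum of non-negative terms includes
  summability. In the last condition summability is automatic: \<open>\<gamma> \<mapsto> \<mu>\<^sup>-\<^sup>1\<gamma>\<close> is a
  bijection from the range fibre of \<open>rng G \<mu>\<close> onto that of \<open>src G \<mu>\<close>, so both terms are summable
  by the first condition.
\<close>

definition topologically_amenable :: "('a, 'b) groupoid_scheme \<Rightarrow> bool" where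
  "topologically_amenable G \<longleftrightarrow>
     (\<exists>g :: nat \<Rightarrow> 'a \<Rightarrow> real.
        (\<forall>n. continuous_map (arrow_space G) euclideanreal (g n) \<and>
             (\<forall>\<gamma> \<in> arrows G. 0 \<le> g n \<gamma>)) \<and>
        (\<forall>n. \<forall>x \<in> units G.
             g n summable_on range_fibre G x \<and> (\<Sum>\<^sub>\<infinity>\<gamma>\<in>range_fibre G x. g n \<gamma>) \<le> 1) \<and>
        (\<forall>K. compactin (unit_space G) K \<longrightarrow>
             uniform_limit K (\<lambda>n x. \<Sum>\<^sub>\<infinity>\<gamma>\<in>range_fibre G x. g n \<gamma>) (\<lambda>x. 1) sequentially) \<and>
        (\<forall>K. compactin (arrow_space G) K \<longrightarrow>
             uniform_limit K
               (\<lambda>n \<mu>. \<Sum>\<^sub>\<infinity>\<gamma>\<in>range_fibre G (rng G \<mu>). \<bar>g n (comp G (ginv G \<mu>) \<gamma>) - g n \<gamma>\<bar>)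
               (\<lambda>\<mu>. 0) sequentially))"

end

theory Submission
  imports Defs "HOL-Real_Asymp.Real_Asymp"
begin

text \<open>
  Fix a compact set \<open>L\<close> of arrows and a continuous bump function \<open>\<phi>\<close> with compact support, equal to
  \<open>1\<close> on \<open>L\<close>, on its inverse and on its ranges and sources. The functions \<open>f\<^sub>0 = \<phi>\<close>,
  \<open>f\<^sub>k\<^sub>+\<^sub>1 = min 1 (\<phi> * f\<^sub>k)\<close> are continuous substitutes for the indicator functions of the balls
  of a length function, which need not be continuous: a translate of \<open>f\<^sub>k\<close> by an element of \<open>L\<close>
  lies between \<open>f\<^sub>k\<^sub>-\<^sub>1\<close> and \<open>f\<^sub>k\<^sub>+\<^sub>1\<close>, and the mass \<open>m\<^sub>k(x)\<close> of \<open>f\<^sub>k\<close> on the range fibre of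
  \<open>x\<close> is bounded by a polynomial in \<open>k\<close>, uniformly in \<open>x\<close>. After normalisation a translation moves
  \<open>f\<^sub>k\<close> by at most \<open>2 (1 - m\<^sub>k\<^sub>-\<^sub>1 / m\<^sub>k\<^sub>+\<^sub>1) \<le> 2 (ln m\<^sub>k\<^sub>+\<^sub>1 - ln m\<^sub>k\<^sub>-\<^sub>1)\<close> in the \<open>\<ell>\<^sup>1\<close>-norm. No single scale \<open>k\<close>
  works for all \<open>x\<close>, but the average over \<open>k \<le> n\<close> telescopes to \<open>O(ln n / n)\<close>, uniformly in \<open>x\<close>.
  A compact exhaustion yields the sequence.
\<close>

section \<open>Sums and logarithms\<close>

text \<open>Both normalised functions dominate \<open>h / M\<close>, and two numbers
  \<open>a\<close>, \<open>b\<close> above a common lower bound \<open>c\<close> satisfy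
  \<open>\<bar>a - b\<bar> \<le> a + b - 2 * c\<close>. Summation turns \<open>a\<close> and
  \<open>b\<close> into 1 each and \<open>c\<close> into \<open>infsum h S / M\<close>.\<close>

lemma infsum_abs_diff_normalised_le:
  fixes u v h :: "'a \<Rightarrow> real"
  assumes summ: "u summable_on S" "v summable_on S" "h summable_on S"
    and nonneg: "\<And>x. x \<in> S \<Longrightarrow> 0 \<le> h x"
    and h: "\<And>x. x \<in> S \<Longrightarrow> h x \<le> u x" "\<And>x. x \<in> S \<Longrightarrow> h x \<le> v x"
    and pos: "infsum u S > 0" "infsum v S > 0"
    and M: "infsum u S \<le> M" "infsum v S \<le> M"
  shows "(\<Sum>\<^sub>\<infinity>x\<in>S. \<bar>v x / infsum v S - u x / infsum u S\<bar>) \<le> 2 * (1 - infsum h S / M)"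
proof -
  define U V where "U = infsum u S" and "V = infsum v S"
  have "M > 0" using pos M by linarith
  have ptwise: "\<bar>v x / V - u x / U\<bar> \<le> v x * inverse V + u x * inverse U + h x * (- 2 / M)" if "x \<in> S" for x
  proof -
    have "h x / M \<le> u x / U" "h x / M \<le> v x / V"
      using frac_le[of "u x" "h x" U M] frac_le[of "v x" "h x" V M] nonneg[OF that] h[OF that] pos M
      by (auto simp: U_def V_def)
    then show ?thesis by (simp add: divide_inverse)
  qed
  have hs: "((\<lambda>x. v x * inverse V + u x * inverse U + h x * (- 2 / M)) has_sum
      (V * inverse V + U * inverse U + infsum h S * (- 2 / M))) S"
    unfolding U_def V_def using summ by (intro has_sum_add has_sum_cmult_left) auto
  note sr = has_sum_imp_summable[OF hs]
  have "(\<lambda>x. \<bar>v x / V - u x / U\<bar>) summable_on S"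
    by (rule summable_on_comparison_test[OF sr]) (use ptwise in auto)
  then have "(\<Sum>\<^sub>\<infinity>x\<in>S. \<bar>v x / V - u x / U\<bar>)
      \<le> (\<Sum>\<^sub>\<infinity>x\<in>S. v x * inverse V + u x * inverse U + h x * (- 2 / M))"
    using sr ptwise by (rule infsum_mono)
  also have "\<dots> = V * inverse V + U * inverse U + infsum h S * (- 2 / M)"
    using hs by (rule infsumI)
  also have "\<dots> = 2 * (1 - infsum h S / M)"
    using pos by (simp add: U_def V_def)
  finally show ?thesis by (simp add: U_def V_def)
qed

text \<open>
  Since \<open>1 - 1/t \<le> ln t\<close>, the relative increments of a positive sequence are dominated by a telescoping sum
  of logarithms.
\<close>

lemma sum_relative_increments_le:
  fixes m :: "nat \<Rightarrow> real"
  assumes m: "\<And>k. 1 \<le> m k" and bound: "m n \<le> B" "m (Suc n) \<le> B"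
  shows "(\<Sum>k<n. 1 - m k / m (k + 2)) \<le> 2 * ln B"
proof -
  have "(\<Sum>k<n. 1 - m k / m (k + 2)) \<le> (\<Sum>k<n. ln (m (k + 2)) - ln (m k))"
  proof (rule sum_mono)
    fix k
    have "0 < m k" "0 < m (k + 2)" using m[of k] m[of "k + 2"] by linarith+
    then have "ln (m k) - ln (m (k + 2)) \<le> m k / m (k + 2) - 1"
      using ln_le_minus_one[of "m k / m (k + 2)"] by (simp add: ln_div)
    then show "1 - m k / m (k + 2) \<le> ln (m (k + 2)) - ln (m k)" by linarith
  qed
  \<comment> \<open>The telescoping advances by two indices, so two terms survive at each end; hence
    the two bounds on \<open>m n\<close> and \<open>m (Suc n)\<close>.\<close>
  also have "\<dots> = (ln (m n) + ln (m (Suc n))) - (ln (m 0) + ln (m 1))"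
    by (induction n) auto
  also have "\<dots> \<le> 2 * ln B"
  proof -
    have "0 < m n" "0 < m (Suc n)" using m[of n] m[of "Suc n"] by linarith+
    then have "ln (m n) \<le> ln B" "ln (m (Suc n)) \<le> ln B"
      using bound by simp_all
    moreover have "0 \<le> ln (m 0)" "0 \<le> ln (m 1)"
      using m by simp_all
    ultimately show ?thesis by linarith
  qed
  finally show ?thesis .
qed

lemma poly_le_monomial:
  fixes p :: "real poly"
  obtains A where "0 < A" "\<And>t. 1 \<le> t \<Longrightarrow> poly p t \<le> A * t ^ degree p"
proof
  show "0 < 1 + (\<Sum>i\<le>degree p. \<bar>coeff p i\<bar>)"
    by (simp add: add_pos_nonneg sum_nonneg)
next
  fix t :: real assume t: "1 \<le> t"
  have "poly p t \<le> (\<Sum>i\<le>degree p. \<bar>coeff p i\<bar> * t ^ degree p)"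
    unfolding poly_altdef
    by (intro sum_mono mult_mono) (use t in \<open>auto intro: power_increasing\<close>)
  also have "\<dots> \<le> (1 + (\<Sum>i\<le>degree p. \<bar>coeff p i\<bar>)) * t ^ degree p"
    using t by (simp add: distrib_right flip: sum_distrib_right)
  finally show "poly p t \<le> (1 + (\<Sum>i\<le>degree p. \<bar>coeff p i\<bar>)) * t ^ degree p" .
qed

text \<open>The logarithm of a polynomial in \<open>n\<close> is \<open>o(n)\<close>. This supplies
  the number \<open>n\<close> of scales to average over: \<open>c\<close> will bound the length on
  the support of the bump function, and \<open>n + 2\<close> is the largest number of convolution
  factors that occurs.\<close>

lemma polynomial_imp_log_average_small:
  fixes p :: "real poly" and c \<epsilon> :: real
  assumes "1 \<le> c" "0 < \<epsilon>"
  obtains n B where "0 < n" "ln B \<le> \<epsilon> * real n" "poly p (c * real (n + 2)) \<le> B" "1 \<le> B"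
proof -
  obtain A where A: "0 < A" "\<And>t. 1 \<le> t \<Longrightarrow> poly p t \<le> A * t ^ degree p"
    using poly_le_monomial by blast
  define d where "d = degree p"
  \<comment> \<open>The factor \<open>A + 1\<close>, rather than \<open>A\<close>, makes
    \<open>B n\<close> at least 1.\<close>
  define B where "B = (\<lambda>n. (A + 1) * (c * real (n + 2)) ^ d)"
  have ge1: "1 \<le> c * real (n + 2)" for n
    using mult_mono[of 1 c 1 "real (n + 2)"] assms by simp
  have lnB: "ln (B n) = ln (A + 1) + real d * (ln c + ln (real n + 2))" for n
  proof -
    have "0 < c * real (n + 2)" using ge1[of n] by linarith
    then have "ln (B n) = ln (A + 1) + real d * ln (c * real (n + 2))"
      unfolding B_def using A(1) assms(1) by (subst ln_mult) (simp_all add: ln_realpow del: of_nat_add)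
    also have "ln (c * real (n + 2)) = ln c + ln (real n + 2)"
      using assms by (subst ln_mult) auto
    finally show ?thesis .
  qed
  have "(\<lambda>n. (ln (A + 1) + real d * (ln c + ln (real n + 2))) / real n) \<longlonglongrightarrow> 0"
    by real_asymp
  then have "\<forall>\<^sub>F n in sequentially. (ln (A + 1) + real d * (ln c + ln (real n + 2))) / real n < \<epsilon>"
    using assms(2) by (rule order_tendstoD)
  then have "\<forall>\<^sub>F n in sequentially. 0 < n \<and> ln (B n) / real n < \<epsilon>"
    using eventually_gt_at_top[of 0] by eventually_elim (simp add: lnB)
  then obtain n where "\<forall>k\<ge>n. 0 < k \<and> ln (B k) / real k < \<epsilon>"
    unfolding eventually_sequentially ..
  then have n: "0 < n" "ln (B n) / real n < \<epsilon>"
    by auto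
  show thesis
  proof
    show "0 < n" by fact
    show "ln (B n) \<le> \<epsilon> * real n" using n by (simp add: field_simps)
    have pw: "1 \<le> (c * real (n + 2)) ^ d" using ge1[of n] by (rule one_le_power)
    have "poly p (c * real (n + 2)) \<le> A * (c * real (n + 2)) ^ d" using A(2)[OF ge1] by (simp add: d_def)
    also have "\<dots> \<le> B n" unfolding B_def using pw by (intro mult_right_mono) auto
    finally show "poly p (c * real (n + 2)) \<le> B n" .
    show "1 \<le> B n"
      unfolding B_def using mult_mono[of 1 "A + 1" 1] pw A(1) by simp
  qed
qed

lemma has_sum_finite_sum:
  fixes f :: "'i \<Rightarrow> 'a \<Rightarrow> real"
  assumes "finite I" "\<And>i. i \<in> I \<Longrightarrow> (f i has_sum s i) A"
  shows "((\<lambda>x. \<Sum>i\<in>I. f i x) has_sum (\<Sum>i\<in>I. s i)) A"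
  using assms by (induction I rule: finite_induct) (auto intro: has_sum_add)

section \<open>Topological preliminaries\<close>

lemma Hausdorff_space_finite_disjoint_nhds:
  assumes "Hausdorff_space X" "finite A" "A \<subseteq> topspace X"
    and "\<And>a. a \<in> A \<Longrightarrow> openin X (V a) \<and> a \<in> V a"
  obtains U where "\<And>a. a \<in> A \<Longrightarrow> openin X (U a) \<and> a \<in> U a \<and> U a \<subseteq> V a"
    and "\<And>a b. a \<in> A \<Longrightarrow> b \<in> A \<Longrightarrow> a \<noteq> b \<Longrightarrow> U a \<inter> U b = {}"
proof -
  have "\<forall>a\<in>A. \<forall>b\<in>A. \<exists>P Q. a \<noteq> b \<longrightarrow> openin X P \<and> openin X Q \<and> a \<in> P \<and> b \<in> Q \<and> disjnt P Q"
    using assms(1,3) unfolding Hausdorff_space_def by (meson subsetD)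
  then obtain P Q where PQ: "\<And>a b. a \<in> A \<Longrightarrow> b \<in> A \<Longrightarrow> a \<noteq> b \<Longrightarrow>
      openin X (P a b) \<and> openin X (Q a b) \<and> a \<in> P a b \<and> b \<in> Q a b \<and> disjnt (P a b) (Q a b)"
    by metis
  \<comment> \<open>The sets chosen for \<open>(a, b)\<close> and for \<open>(b, a)\<close> are
    unrelated, so \<open>U a\<close> is cut down by both \<open>P a b\<close> and
    \<open>Q b a\<close>; then \<open>U a \<subseteq> P a b\<close> and
    \<open>U b \<subseteq> Q a b\<close> are disjoint. The outer \<open>V a\<close> takes care of a
    singleton \<open>A\<close>, where the intersection is over the empty family.\<close>
  define U where "U = (\<lambda>a. V a \<inter> (\<Inter>b\<in>A - {a}. P a b \<inter> Q b a \<inter> V a))"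
  show thesis
  proof
    fix a assume a: "a \<in> A"
    have "openin X (U a)"
    proof (cases "A - {a} = {}")
      case True
      then show ?thesis using assms(4)[OF a] by (simp add: U_def)
    next
      case False
      have "openin X (\<Inter>b\<in>A - {a}. P a b \<inter> Q b a \<inter> V a)"
        using False assms(2) PQ[OF a] PQ[OF _ a] assms(4)[OF a]
        by (intro openin_Inter) (auto intro!: openin_Int)
      then show ?thesis
        unfolding U_def using assms(4)[OF a] by (intro openin_Int) auto
    qed
    moreover have "a \<in> U a"
      using PQ[OF a] PQ[OF _ a] assms(4)[OF a] unfolding U_def by auto
    ultimately show "openin X (U a) \<and> a \<in> U a \<and> U a \<subseteq> V a"
      by (auto simp: U_def)
  next
    fix a b assume ab: "a \<in> A" "b \<in> A" "a \<noteq> b"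
    then show "U a \<inter> U b = {}"
      using PQ[OF ab] by (auto simp: U_def disjnt_def)
  qed
qed

text \<open>By local compactness, those members of a countable base that lie in a compact set still
  cover the space. Finitely many of them cover a given compact set, so the finite unions of their
  compact enclosures eventually absorb it.\<close>

lemma compact_exhaustion:
  assumes "second_countable X" "locally_compact_space X" "Hausdorff_space X"
  obtains K :: "nat \<Rightarrow> 'a set" where "\<And>n. compactin X (K n)"
    and "\<And>C. compactin X C \<Longrightarrow> \<forall>\<^sub>F n in sequentially. C \<subseteq> K n"
proof -
  obtain \<B> where \<B>: "countable \<B>" "\<And>V. V \<in> \<B> \<Longrightarrow> openin X V"
    "\<And>U x. openin X U \<Longrightarrow> x \<in> U \<Longrightarrow> \<exists>V \<in> \<B>. x \<in> V \<and> V \<subseteq> U"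
    using assms(1) unfolding second_countable_def by metis
  \<comment> \<open>The empty set is added so that the family can be enumerated by the natural
    numbers even when the space is empty.\<close>
  define \<B>' where "\<B>' = insert {} {V \<in> \<B>. \<exists>K. compactin X K \<and> V \<subseteq> K}"
  have "countable \<B>'" "\<B>' \<noteq> {}"
    using \<B>(1) by (auto simp: \<B>'_def)
  then obtain U :: "nat \<Rightarrow> 'a set" where U: "range U = \<B>'"
    using uncountable_def by metis
  have opU: "openin X (U n)" for n
  proof -
    have "U n \<in> \<B>'" using U by auto
    then show ?thesis using \<B>(2) by (auto simp: \<B>'_def)
  qed
  have "\<exists>K. compactin X K \<and> U n \<subseteq> K" for n
  proof -
    have "U n \<in> \<B>'" using U by auto
    then show ?thesis by (auto simp: \<B>'_def)
  qed
  then obtain L where L: "\<And>n. compactin X (L n) \<and> U n \<subseteq> L n"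
    by metis
  show thesis
  proof
    show "compactin X (\<Union>i\<le>n. L i)" for n
      by (rule compactin_Union) (use L in auto)
  next
    fix C assume C: "compactin X C"
    have "C \<subseteq> \<Union>(range U)"
    proof
      fix x assume "x \<in> C"
      then have x: "x \<in> topspace X" using C compactin_subset_topspace by blast
      obtain W K where "openin X W" "compactin X K" "x \<in> W" "W \<subseteq> K"
        using assms(2) x unfolding locally_compact_space_def by blast
      then obtain V where "V \<in> \<B>" "x \<in> V" "V \<subseteq> W" using \<B>(3) by blast
      moreover from this have "V \<subseteq> K" using \<open>W \<subseteq> K\<close> by blast
      ultimately have "V \<in> \<B>'" using \<open>compactin X K\<close> unfolding \<B>'_def by blast
      then show "x \<in> \<Union>(range U)" using U \<open>x \<in> V\<close> by blast
    qed
    then obtain \<F> where \<F>: "finite \<F>" "\<F> \<subseteq> range U" "C \<subseteq> \<Union>\<F>"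
      using C opU unfolding compactin_def by (metis (no_types, lifting) rangeE)
    then obtain I where I: "finite I" "\<F> = U ` I"
      by (meson finite_subset_image)
    obtain m where m: "\<And>i. i \<in> I \<Longrightarrow> i \<le> m"
      using I(1) finite_nat_set_iff_bounded_le by auto
    show "\<forall>\<^sub>F n in sequentially. C \<subseteq> (\<Union>i\<le>n. L i)"
    proof (rule eventually_sequentiallyI)
      fix n assume "m \<le> n"
      show "C \<subseteq> (\<Union>i\<le>n. L i)"
      proof
        fix x assume "x \<in> C"
        then obtain i where "i \<in> I" "x \<in> U i" using \<F>(3) I(2) by auto
        then show "x \<in> (\<Union>i\<le>n. L i)" using L m[of i] \<open>m \<le> n\<close> by (auto intro!: bexI[of _ i])
      qed
    qed
  qed
qed

section \<open>Sums over the range fibres\<close>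

context groupoid
begin

lemma range_fibreD:
  assumes "\<gamma> \<in> range_fibre G x"
  shows "\<gamma> \<in> arrows G" "rng G \<gamma> = x" "x \<in> units G"
  using assms rng_closed by (auto simp: range_fibre_def)

lemma unit_in_range_fibre: "x \<in> units G \<Longrightarrow> x \<in> range_fibre G x"
  using units_subset rng_unit by (auto simp: range_fibre_def)

lemma units_arrow: "x \<in> units G \<Longrightarrow> x \<in> arrows G"
  using units_subset by auto

lemma composableI:
  "\<gamma> \<in> arrows G \<Longrightarrow> \<mu> \<in> arrows G \<Longrightarrow> src G \<gamma> = rng G \<mu> \<Longrightarrow> (\<gamma>, \<mu>) \<in> composable_pairs G"
  by (simp add: composable_pairs_def)

lemma left_translate_in_range_fibre:
  assumes "\<mu> \<in> arrows G" "\<gamma> \<in> range_fibre G (src G \<mu>)"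
  shows "comp G \<mu> \<gamma> \<in> range_fibre G (rng G \<mu>)"
proof -
  have "(\<mu>, \<gamma>) \<in> composable_pairs G"
    using assms by (auto simp: range_fibre_def composable_pairs_def)
  then show ?thesis
    using comp_closed rng_comp by (auto simp: range_fibre_def)
qed

lemma inverse_translate_in_range_fibre:
  assumes "\<mu> \<in> arrows G" "\<gamma> \<in> range_fibre G (rng G \<mu>)"
  shows "comp G (ginv G \<mu>) \<gamma> \<in> range_fibre G (src G \<mu>)"
  using left_translate_in_range_fibre[of "ginv G \<mu>" \<gamma>] assms
  by (simp add: ginv_closed rng_ginv src_ginv)

lemma comp_ginv_cancel_left:
  assumes "\<mu> \<in> arrows G" "\<gamma> \<in> range_fibre G (src G \<mu>)"
  shows "comp G (ginv G \<mu>) (comp G \<mu> \<gamma>) = \<gamma>"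
proof -
  note \<gamma> = range_fibreD[OF assms(2)]
  have "comp G (comp G (ginv G \<mu>) \<mu>) \<gamma> = comp G (ginv G \<mu>) (comp G \<mu> \<gamma>)"
    using assms(1) \<gamma> by (intro comp_assoc composableI) (auto simp: ginv_closed src_ginv)
  then show ?thesis
    using assms(1) \<gamma> comp_rng_left[of \<gamma>] by (simp add: comp_ginv_left)
qed

lemma comp_cancel_ginv_left:
  assumes "\<mu> \<in> arrows G" "\<gamma> \<in> range_fibre G (rng G \<mu>)"
  shows "comp G \<mu> (comp G (ginv G \<mu>) \<gamma>) = \<gamma>"
proof -
  note \<gamma> = range_fibreD[OF assms(2)]
  have "comp G (comp G \<mu> (ginv G \<mu>)) \<gamma> = comp G \<mu> (comp G (ginv G \<mu>) \<gamma>)"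
    using assms(1) \<gamma> by (intro comp_assoc composableI) (auto simp: ginv_closed src_ginv rng_ginv)
  then show ?thesis
    using assms(1) \<gamma> comp_rng_left[of \<gamma>] by (simp add: comp_ginv_right)
qed

lemma bij_betw_left_translate:
  assumes "\<mu> \<in> arrows G"
  shows "bij_betw (comp G (ginv G \<mu>)) (range_fibre G (rng G \<mu>)) (range_fibre G (src G \<mu>))"
  by (rule bij_betw_byWitness[where f' = "comp G \<mu>"])
    (use assms left_translate_in_range_fibre inverse_translate_in_range_fibre
      comp_ginv_cancel_left comp_cancel_ginv_left in auto)

lemma ginv_ginv:
  assumes "\<gamma> \<in> arrows G"
  shows "ginv G (ginv G \<gamma>) = \<gamma>"
proof -
  have i: "ginv G \<gamma> \<in> arrows G" "ginv G (ginv G \<gamma>) \<in> arrows G"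
    using assms ginv_closed by auto
  have "\<gamma> \<in> range_fibre G (src G (ginv G \<gamma>))"
    using assms by (simp add: range_fibre_def src_ginv)
  from comp_ginv_cancel_left[OF i(1) this]
  have "comp G (ginv G (ginv G \<gamma>)) (src G \<gamma>) = \<gamma>"
    using assms by (simp add: comp_ginv_left)
  then show ?thesis
    using comp_src_right[OF i(2)] assms i by (simp add: src_ginv rng_ginv)
qed

end

section \<open>Continuity of range, source and division; products of compact sets\<close>

context topological_groupoid
begin

lemma continuous_rng: "continuous_map (arrow_space G) (arrow_space G) (rng G)"
proof -
  have "continuous_map (arrow_space G)
      (subtopology (prod_topology (arrow_space G) (arrow_space G)) (composable_pairs G))
      (\<lambda>\<gamma>. (\<gamma>, ginv G \<gamma>))"
    using continuous_ginv
    by (auto simp: continuous_map_in_subtopology continuous_map_pairedI composable_pairs_def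
        ginv_closed rng_ginv)
  from continuous_map_compose[OF this continuous_comp] show ?thesis
    by (rule continuous_map_eq) (auto simp: comp_ginv_right)
qed

lemma continuous_rng_unit_space: "continuous_map (arrow_space G) (unit_space G) (rng G)"
  using continuous_rng rng_closed by (auto simp: unit_space_def continuous_map_in_subtopology)

lemma continuous_src: "continuous_map (arrow_space G) (arrow_space G) (src G)"
  using continuous_map_compose[OF continuous_ginv continuous_rng]
  by (rule continuous_map_eq) (auto simp: rng_ginv)

text \<open>This is the argument of the second factor in a convolution. The pairs are restricted to
  equal ranges so that the inverse of the second entry is composable with the first.\<close>

lemma continuous_left_division:
  "continuous_map (subtopology (prod_topology (arrow_space G) (arrow_space G))
      {(\<gamma>, \<mu>). rng G \<mu> = rng G \<gamma>}) (arrow_space G) (\<lambda>(\<gamma>, \<mu>). comp G (ginv G \<mu>) \<gamma>)"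
    (is "continuous_map ?Z _ _")
proof -
  have "continuous_map ?Z (arrow_space G) (ginv G \<circ> snd)"
    by (rule continuous_map_compose[OF _ continuous_ginv])
      (simp add: continuous_map_from_subtopology continuous_map_snd)
  moreover have "continuous_map ?Z (arrow_space G) fst"
    by (simp add: continuous_map_from_subtopology continuous_map_fst)
  ultimately have "continuous_map ?Z (prod_topology (arrow_space G) (arrow_space G))
      (\<lambda>p. ((ginv G \<circ> snd) p, fst p))"
    by (rule continuous_map_pairedI)
  then have "continuous_map ?Z
      (subtopology (prod_topology (arrow_space G) (arrow_space G)) (composable_pairs G))
      (\<lambda>p. ((ginv G \<circ> snd) p, fst p))"
    by (auto simp: continuous_map_in_subtopology composable_pairs_def ginv_closed src_ginv)
  from continuous_map_compose[OF this continuous_comp] show ?thesis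
    by (rule continuous_map_eq) auto
qed

text \<open>In a Hausdorff groupoid the composable pairs form a closed set, being the equaliser of
  two continuous maps, so those inside \<open>C \<times> D\<close> form a compact set, whose image
  under composition is compact.\<close>

lemma compactin_product:
  assumes "Hausdorff_space (arrow_space G)"
    and "compactin (arrow_space G) C" "compactin (arrow_space G) D"
  shows "compactin (arrow_space G) ((\<lambda>(\<gamma>, \<mu>). comp G \<gamma> \<mu>) ` (C \<times> D \<inter> composable_pairs G))"
proof (rule image_compactin[OF _ continuous_comp])
  let ?P = "prod_topology (arrow_space G) (arrow_space G)"
  have "closedin ?P {p \<in> topspace ?P. (src G \<circ> fst) p = (rng G \<circ> snd) p}"
    by (rule closedin_continuous_maps_eq[OF assms(1)];
      rule continuous_map_compose[OF _ continuous_src] continuous_map_compose[OF _ continuous_rng])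
      (simp_all add: continuous_map_fst continuous_map_snd)
  moreover have "{p \<in> topspace ?P. (src G \<circ> fst) p = (rng G \<circ> snd) p} = composable_pairs G"
    by (auto simp: composable_pairs_def)
  ultimately have "compactin ?P (composable_pairs G \<inter> C \<times> D)"
    using assms by (intro closed_Int_compactin) (auto simp: compactin_Times)
  then show "compactin (subtopology ?P (composable_pairs G)) (C \<times> D \<inter> composable_pairs G)"
    by (auto simp: compactin_subtopology Int_commute)
qed

end

section \<open>Local sections of the range map and continuity of fibrewise sums\<close>

context lch_etale_groupoid
begin

text \<open>The section is the local inverse of the range map. Openness of the image is recorded for
  all open subsets of \<open>V\<close>, because the neighbourhoods will later be shrunk to be
  disjoint.\<close>

lemma obtain_local_section:
  assumes "\<gamma> \<in> arrows G"
  obtains V \<sigma> where "openin (arrow_space G) V" "\<gamma> \<in> V"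
    "\<And>U. openin (arrow_space G) U \<Longrightarrow> U \<subseteq> V \<Longrightarrow> openin (unit_space G) (rng G ` U)"
    "continuous_map (subtopology (unit_space G) (rng G ` V)) (arrow_space G) \<sigma>"
    "\<And>\<mu>. \<mu> \<in> V \<Longrightarrow> \<sigma> (rng G \<mu>) = \<mu>"
proof -
  obtain V where V: "openin (arrow_space G) V" "\<gamma> \<in> V" "openin (unit_space G) (rng G ` V)"
    and hom: "homeomorphic_map (subtopology (arrow_space G) V)
      (subtopology (unit_space G) (rng G ` V)) (rng G)"
    using etale assms unfolding local_homeomorphism_map_def by blast
  then obtain \<sigma> where \<sigma>: "homeomorphic_maps (subtopology (arrow_space G) V)
      (subtopology (unit_space G) (rng G ` V)) (rng G) \<sigma>"
    unfolding homeomorphic_map_maps by blast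
  have VX: "V \<subseteq> arrows G" using V(1) openin_subset by blast
  show thesis
  proof
    fix U assume U: "openin (arrow_space G) U" "U \<subseteq> V"
    have "openin (subtopology (unit_space G) (rng G ` V)) (rng G ` U)"
      using homeomorphic_imp_open_map[OF hom] U V(1)
      unfolding open_map_def by (simp add: openin_open_subtopology)
    then show "openin (unit_space G) (rng G ` U)"
      using V(3) by (simp add: openin_open_subtopology)
  qed (use V \<sigma> VX in \<open>auto simp: homeomorphic_maps_def continuous_map_in_subtopology\<close>)
qed

text \<open>The fibre over a unit is closed, as points are closed, and discrete, as the range map is
  locally injective. A compact discrete set is finite.\<close>

lemma finite_range_fibre_Int_compact:
  assumes C: "compactin (arrow_space G) C"
  shows "finite (range_fibre G x \<inter> C)"
proof (cases "x \<in> units G")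
  case False
  then have "range_fibre G x = {}" using range_fibreD(3) by blast
  then show ?thesis by simp
next
  case True
  have "closedin (arrow_space G) {\<gamma> \<in> topspace (arrow_space G). rng G \<gamma> \<in> {x}}"
    using True units_arrow Hausdorff
    by (intro closedin_continuous_map_preimage[OF continuous_rng]) (simp add: closedin_Hausdorff_sing_eq)
  then have "compactin (arrow_space G) (range_fibre G x \<inter> C)"
    using C by (intro closed_Int_compactin) (auto simp: range_fibre_def)
  moreover have "\<exists>V. openin (arrow_space G) V \<and> \<gamma> \<in> V \<and> V \<inter> range_fibre G x \<subseteq> {\<gamma>}"
    if \<gamma>: "\<gamma> \<in> range_fibre G x \<inter> C" for \<gamma>
  proof -
    have "\<gamma> \<in> arrows G" using \<gamma> range_fibreD by blast
    then obtain V \<sigma> where V: "openin (arrow_space G) V" "\<gamma> \<in> V"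
      "\<And>\<mu>. \<mu> \<in> V \<Longrightarrow> \<sigma> (rng G \<mu>) = \<mu>"
      by (metis obtain_local_section)
    have "\<mu> = \<gamma>" if "\<mu> \<in> V" "\<mu> \<in> range_fibre G x" for \<mu>
      using V(3)[OF that(1)] V(3)[OF V(2)] that(2) \<gamma> by (auto simp: range_fibre_def)
    then show ?thesis using V by blast
  qed
  then obtain V where V: "\<And>\<gamma>. \<gamma> \<in> range_fibre G x \<inter> C \<Longrightarrow>
      openin (arrow_space G) (V \<gamma>) \<and> \<gamma> \<in> V \<gamma> \<and> V \<gamma> \<inter> range_fibre G x \<subseteq> {\<gamma>}"
    by metis
  ultimately obtain \<F> where "finite \<F>" "\<F> \<subseteq> V ` (range_fibre G x \<inter> C)" "range_fibre G x \<inter> C \<subseteq> \<Union>\<F>"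
    unfolding compactin_def by (smt (verit, best) UN_I imageE subsetI)
  then obtain T where T: "finite T" "T \<subseteq> range_fibre G x \<inter> C" "range_fibre G x \<inter> C \<subseteq> \<Union>(V ` T)"
    by (metis finite_subset_image)
  have "range_fibre G x \<inter> C \<subseteq> T"
    using T V by blast
  then show ?thesis using T(1) finite_subset by blast
qed

text \<open>
  Near a point \<open>y\<^sub>0\<close> the sum runs over finitely many local sections of the range map, one through
  each point of the fibre that lies in \<open>C\<close>; compactness of \<open>C\<close> excludes further points.
\<close>

lemma continuous_map_fibre_infsum:
  fixes F :: "'c \<Rightarrow> 'a \<Rightarrow> real"
  assumes \<rho>: "continuous_map Y (unit_space G) \<rho>"
    and C: "compactin (arrow_space G) C"
    and F: "continuous_map (subtopology (prod_topology Y (arrow_space G)) {(y, \<mu>). rng G \<mu> = \<rho> y})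
      euclideanreal (\<lambda>(y, \<mu>). F y \<mu>)"
    and zero: "\<And>y \<mu>. y \<in> topspace Y \<Longrightarrow> \<mu> \<in> range_fibre G (\<rho> y) - C \<Longrightarrow> F y \<mu> = 0"
  shows "continuous_map Y euclideanreal (\<lambda>y. \<Sum>\<^sub>\<infinity>\<mu>\<in>range_fibre G (\<rho> y). F y \<mu>)" (is "continuous_map _ _ ?S")
proof -
  have CX: "C \<subseteq> arrows G" using C compactin_subset_topspace by blast
  have loc: "\<exists>W. openin Y W \<and> y0 \<in> W \<and> continuous_map (subtopology Y W) euclideanreal ?S"
    if y0: "y0 \<in> topspace Y" for y0
  proof -
    define A where "A = range_fibre G (\<rho> y0) \<inter> C"
    have finA: "finite A" unfolding A_def by (rule finite_range_fibre_Int_compact[OF C])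
    have AX: "A \<subseteq> arrows G" using CX by (auto simp: A_def)
    have "\<exists>V \<sigma>. openin (arrow_space G) V \<and> a \<in> V \<and>
        (\<forall>U. openin (arrow_space G) U \<longrightarrow> U \<subseteq> V \<longrightarrow> openin (unit_space G) (rng G ` U)) \<and>
        continuous_map (subtopology (unit_space G) (rng G ` V)) (arrow_space G) \<sigma> \<and>
        (\<forall>\<mu>\<in>V. \<sigma> (rng G \<mu>) = \<mu>)" if "a \<in> A" for a
      using obtain_local_section[of a] AX that by (metis subsetD)
    then obtain V \<sigma> where V: "\<And>a. a \<in> A \<Longrightarrow> openin (arrow_space G) (V a) \<and> a \<in> V a"
      and Vop: "\<And>a U. a \<in> A \<Longrightarrow> openin (arrow_space G) U \<Longrightarrow> U \<subseteq> V a \<Longrightarrow> openin (unit_space G) (rng G ` U)"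
      and \<sigma>c: "\<And>a. a \<in> A \<Longrightarrow> continuous_map (subtopology (unit_space G) (rng G ` V a)) (arrow_space G) (\<sigma> a)"
      and \<sigma>: "\<And>a \<mu>. a \<in> A \<Longrightarrow> \<mu> \<in> V a \<Longrightarrow> \<sigma> a (rng G \<mu>) = \<mu>"
      by metis
    obtain U where U: "\<And>a. a \<in> A \<Longrightarrow> openin (arrow_space G) (U a) \<and> a \<in> U a \<and> U a \<subseteq> V a"
      and disj: "\<And>a b. a \<in> A \<Longrightarrow> b \<in> A \<Longrightarrow> a \<noteq> b \<Longrightarrow> U a \<inter> U b = {}"
      using Hausdorff_space_finite_disjoint_nhds[OF Hausdorff finA AX V] by metis
    \<comment> \<open>\<open>D\<close> is the part of \<open>C\<close> missed by the chosen
      neighbourhoods. It is compact, so its range image is closed and may be removed. Over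
      \<open>N\<close> every point of \<open>C\<close> then lies in some \<open>U a\<close>, and
      every \<open>U a\<close> has a point in the fibre. For empty \<open>A\<close> the first factor
      of \<open>N\<close> alone keeps it inside the unit space.\<close>
    define D where "D = C - (\<Union>a\<in>A. U a)"
    define N where "N = (topspace (unit_space G) - rng G ` D) \<inter>
      (\<Inter>a\<in>A. rng G ` U a \<inter> topspace (unit_space G))"
    define W where "W = {y \<in> topspace Y. \<rho> y \<in> N}"
    have "openin (arrow_space G) (\<Union>a\<in>A. U a)"
      using U by blast
    then have "closedin (arrow_space G) (arrows G - (\<Union>a\<in>A. U a))"
      by (simp add: closedin_def openin_subset double_diff)
    moreover have "(arrows G - (\<Union>a\<in>A. U a)) \<inter> C = D"
      using CX by (auto simp: D_def)
    ultimately have "compactin (arrow_space G) D"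
      using closed_Int_compactin[OF _ C] by metis
    then have "compactin (unit_space G) (rng G ` D)"
      using continuous_rng_unit_space image_compactin by blast
    then have "closedin (unit_space G) (rng G ` D)"
      by (intro compactin_imp_closedin) (simp_all add: unit_space_def Hausdorff Hausdorff_space_subtopology)
    then have op1: "openin (unit_space G) (topspace (unit_space G) - rng G ` D)"
      by blast
    have opN: "openin (unit_space G) N"
    proof (cases "A = {}")
      case True
      then show ?thesis using op1 by (simp add: N_def)
    next
      case False
      have "openin (unit_space G) (\<Inter>a\<in>A. rng G ` U a \<inter> topspace (unit_space G))"
        using False finA U Vop by (intro openin_Inter) (auto intro!: openin_Int)
      then show ?thesis unfolding N_def using op1 by blast
    qed
    then have opW: "openin Y W"
      unfolding W_def using \<rho> openin_continuous_map_preimage by blast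
    have \<rho>0: "\<rho> y0 \<in> topspace (unit_space G)"
      using \<rho> y0 continuous_map_funspace by (metis PiE)
    have "\<rho> y0 \<notin> rng G ` D"
    proof
      assume "\<rho> y0 \<in> rng G ` D"
      then obtain d where d: "d \<in> D" "rng G d = \<rho> y0" by auto
      then have "d \<in> A" using CX by (auto simp: A_def D_def range_fibre_def)
      then show False using U d by (auto simp: D_def)
    qed
    moreover have "\<rho> y0 \<in> rng G ` U a" if "a \<in> A" for a
      using U[OF that] that by (metis (mono_tags, lifting) A_def IntD1 imageI range_fibreD(2))
    ultimately have y0W: "y0 \<in> W"
      using y0 \<rho>0 by (auto simp: W_def N_def)
    have sec: "\<sigma> a (\<rho> y) \<in> U a \<and> rng G (\<sigma> a (\<rho> y)) = \<rho> y" if "y \<in> W" "a \<in> A" for y a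
    proof -
      have "\<rho> y \<in> rng G ` U a"
        using \<open>y \<in> W\<close> \<open>a \<in> A\<close> by (auto simp: W_def N_def split: if_splits)
      then obtain u where "u \<in> U a" "rng G u = \<rho> y"
        by auto
      moreover from this have "\<sigma> a (\<rho> y) = u"
        using \<sigma>[OF \<open>a \<in> A\<close>, of u] U[OF \<open>a \<in> A\<close>] by auto
      ultimately show ?thesis by simp
    qed
    have UX: "U a \<subseteq> arrows G" if "a \<in> A" for a
      using U[OF that] openin_subset by blast
    have eq: "?S y = (\<Sum>a\<in>A. F y (\<sigma> a (\<rho> y)))" if y: "y \<in> W" for y
    proof -
      have yY: "y \<in> topspace Y" using y by (simp add: W_def)
      \<comment> \<open>Over \<open>W\<close> a point of the fibre that is on no section lies
        outside \<open>C\<close>, where \<open>F\<close> vanishes. The \<open>U a\<close> are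
        disjoint, so distinct sections give distinct points and the sum can be indexed by
        \<open>A\<close>.\<close>
      have "?S y = infsum (F y) ((\<lambda>a. \<sigma> a (\<rho> y)) ` A)"
      proof (rule infsum_cong_neutral)
        fix \<mu> assume "\<mu> \<in> (\<lambda>a. \<sigma> a (\<rho> y)) ` A - range_fibre G (\<rho> y)"
        then show "F y \<mu> = 0"
          using sec[OF y] UX by (fastforce simp: range_fibre_def)
      next
        fix \<mu> assume \<mu>: "\<mu> \<in> range_fibre G (\<rho> y) - (\<lambda>a. \<sigma> a (\<rho> y)) ` A"
        have "\<mu> \<notin> C"
        proof
          assume "\<mu> \<in> C"
          have r: "rng G \<mu> = \<rho> y" using \<mu> by (simp add: range_fibre_def)
          have "\<rho> y \<notin> rng G ` D" using y by (simp add: W_def N_def)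
          then have "\<mu> \<notin> D" using r by (metis imageI)
          then obtain a where a: "a \<in> A" "\<mu> \<in> U a" using \<open>\<mu> \<in> C\<close> by (auto simp: D_def)
          then have "\<sigma> a (\<rho> y) = \<mu>" using \<sigma>[of a \<mu>] U[of a] r by auto
          then show False using \<mu> a by auto
        qed
        then show "F y \<mu> = 0" using zero[OF yY] \<mu> by auto
      qed auto
      also have "\<dots> = sum (F y) ((\<lambda>a. \<sigma> a (\<rho> y)) ` A)"
        using finA by simp
      also have "\<dots> = (\<Sum>a\<in>A. F y (\<sigma> a (\<rho> y)))"
      proof (rule sum.reindex_cong[where l = "\<lambda>a. \<sigma> a (\<rho> y)"])
        show "inj_on (\<lambda>a. \<sigma> a (\<rho> y)) A"
        proof (rule inj_onI, rule ccontr)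
          fix a b assume "a \<in> A" "b \<in> A" "\<sigma> a (\<rho> y) = \<sigma> b (\<rho> y)" "a \<noteq> b"
          then show False
            using sec[OF y, of a] sec[OF y, of b] disj[of a b] by auto
        qed
      qed auto
      finally show ?thesis .
    qed
    have "continuous_map (subtopology Y W) euclideanreal (\<lambda>y. \<Sum>a\<in>A. F y (\<sigma> a (\<rho> y)))"
    proof (rule continuous_map_sum[OF finA])
      fix a assume a: "a \<in> A"
      have "\<rho> y \<in> rng G ` V a" if "y \<in> W" for y
        using sec[OF that a] U[OF a] by (metis imageI subsetD)
      then have "continuous_map (subtopology Y W) (subtopology (unit_space G) (rng G ` V a)) \<rho>"
        using \<rho> by (simp add: continuous_map_in_subtopology continuous_map_from_subtopology image_subset_iff_funcset Pi_iff)
      from continuous_map_compose[OF this \<sigma>c[OF a]]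
      have "continuous_map (subtopology Y W) (arrow_space G) (\<lambda>y. \<sigma> a (\<rho> y))"
        by (simp add: o_def)
      then have "continuous_map (subtopology Y W) (prod_topology Y (arrow_space G)) (\<lambda>y. (y, \<sigma> a (\<rho> y)))"
        by (intro continuous_map_pairedI) auto
      then have "continuous_map (subtopology Y W)
          (subtopology (prod_topology Y (arrow_space G)) {(y, \<mu>). rng G \<mu> = \<rho> y}) (\<lambda>y. (y, \<sigma> a (\<rho> y)))"
        using sec[OF _ a] by (auto simp: continuous_map_in_subtopology)
      from continuous_map_compose[OF this F]
      show "continuous_map (subtopology Y W) euclidean (\<lambda>y. F y (\<sigma> a (\<rho> y)))"
        by (simp add: o_def)
    qed
    then have "continuous_map (subtopology Y W) euclideanreal ?S"
      by (rule continuous_map_eq) (simp add: eq)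
    then show ?thesis using opW y0W by blast
  qed
  \<comment> \<open>The local pieces are restrictions of the single function \<open>?S\<close>, so
    their agreement on overlaps is automatic.\<close>
  show ?thesis
    by (rule pasting_lemma[where I = "{W. openin Y W \<and> continuous_map (subtopology Y W) euclideanreal ?S}"
          and T = "\<lambda>W. W" and f = "\<lambda>W. ?S"]) (use loc in auto)
qed

section \<open>Truncated convolution powers\<close>


text \<open>In a Hausdorff space this amounts to compactness of the closed support; any compact
  superset of the support may serve as witness.\<close>

definition compactly_supported :: "('a \<Rightarrow> real) \<Rightarrow> bool" where
  "compactly_supported f \<longleftrightarrow> (\<exists>C. compactin (arrow_space G) C \<and> (\<forall>\<gamma>\<in>arrows G - C. f \<gamma> = 0))"

definition convolution :: "('a \<Rightarrow> real) \<Rightarrow> ('a \<Rightarrow> real) \<Rightarrow> 'a \<Rightarrow> real" where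
  "convolution \<phi> f \<gamma> = (\<Sum>\<^sub>\<infinity>\<mu>\<in>range_fibre G (rng G \<gamma>). \<phi> \<mu> * f (comp G (ginv G \<mu>) \<gamma>))"

definition fibre_mass :: "('a \<Rightarrow> real) \<Rightarrow> 'a \<Rightarrow> real" where
  "fibre_mass f x = (\<Sum>\<^sub>\<infinity>\<gamma>\<in>range_fibre G x. f \<gamma>)"

lemma summable_on_range_fibre:
  assumes "compactly_supported f"
  shows "f summable_on range_fibre G x"
proof -
  obtain C where C: "compactin (arrow_space G) C" "\<And>\<gamma>. \<gamma> \<in> arrows G - C \<Longrightarrow> f \<gamma> = 0"
    using assms unfolding compactly_supported_def by blast
  have "f summable_on (range_fibre G x \<inter> C)"
    using finite_range_fibre_Int_compact[OF C(1)] by simp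
  then show ?thesis
    by (rule summable_on_cong_neutral[THEN iffD1, rotated -1]) (use C(2) in \<open>auto simp: range_fibre_def\<close>)
qed

lemma compactly_supported_mult:
  assumes "compactly_supported \<phi>"
  shows "compactly_supported (\<lambda>\<gamma>. \<phi> \<gamma> * f \<gamma>)"
  using assms unfolding compactly_supported_def by (metis mult_zero_left)

text \<open>Evaluating the mass at \<open>rng G \<gamma>\<close> gives a function on arrows, the
  form in which it later enters as a denominator.\<close>

lemma continuous_fibre_mass:
  assumes "continuous_map (arrow_space G) euclideanreal f" "compactly_supported f"
  shows "continuous_map (arrow_space G) euclideanreal (\<lambda>\<gamma>. fibre_mass f (rng G \<gamma>))"
proof -
  obtain C where C: "compactin (arrow_space G) C" "\<And>\<gamma>. \<gamma> \<in> arrows G - C \<Longrightarrow> f \<gamma> = 0"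
    using assms(2) unfolding compactly_supported_def by blast
  have "continuous_map (subtopology (prod_topology (arrow_space G) (arrow_space G))
      {(\<gamma>, \<mu>). rng G \<mu> = rng G \<gamma>}) euclideanreal (f \<circ> snd)"
    by (rule continuous_map_compose[OF _ assms(1)])
      (simp add: continuous_map_from_subtopology continuous_map_snd)
  then show ?thesis
    unfolding fibre_mass_def
    by (intro continuous_map_fibre_infsum[OF continuous_rng_unit_space C(1)])
      (use C(2) in \<open>auto simp: o_def case_prod_unfold range_fibre_def\<close>)
qed

lemma continuous_convolution:
  assumes \<phi>: "continuous_map (arrow_space G) euclideanreal \<phi>" "compactly_supported \<phi>"
    and f: "continuous_map (arrow_space G) euclideanreal f"
  shows "continuous_map (arrow_space G) euclideanreal (convolution \<phi> f)"
proof -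
  obtain C where C: "compactin (arrow_space G) C" "\<And>\<gamma>. \<gamma> \<in> arrows G - C \<Longrightarrow> \<phi> \<gamma> = 0"
    using \<phi>(2) unfolding compactly_supported_def by blast
  have "continuous_map (subtopology (prod_topology (arrow_space G) (arrow_space G))
      {(\<gamma>, \<mu>). rng G \<mu> = rng G \<gamma>}) euclideanreal (\<phi> \<circ> snd)"
    by (rule continuous_map_compose[OF _ \<phi>(1)])
      (simp add: continuous_map_from_subtopology continuous_map_snd)
  from continuous_map_real_mult[OF this continuous_map_compose[OF continuous_left_division f]]
  show ?thesis
    unfolding convolution_def
    by (intro continuous_map_fibre_infsum[OF continuous_rng_unit_space C(1)])
      (use C(2) in \<open>auto simp: o_def case_prod_unfold range_fibre_def\<close>)
qed

text \<open>A nonzero fibre sum has a nonzero term. This controls both the support of a convolution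
  and the length of the arrows in it.\<close>

lemma convolution_neq_0D:
  assumes "convolution \<phi> f \<gamma> \<noteq> 0" "\<gamma> \<in> arrows G"
  obtains \<mu> \<nu> where "(\<mu>, \<nu>) \<in> composable_pairs G" "\<phi> \<mu> \<noteq> 0" "f \<nu> \<noteq> 0" "\<gamma> = comp G \<mu> \<nu>"
proof -
  obtain \<mu> where \<mu>: "\<mu> \<in> range_fibre G (rng G \<gamma>)" "\<phi> \<mu> * f (comp G (ginv G \<mu>) \<gamma>) \<noteq> 0"
    using assms(1) infsum_0[of "range_fibre G (rng G \<gamma>)" "\<lambda>\<mu>. \<phi> \<mu> * f (comp G (ginv G \<mu>) \<gamma>)"]
    unfolding convolution_def by blast
  have r: "rng G \<mu> = rng G \<gamma>" "\<mu> \<in> arrows G" using range_fibreD[OF \<mu>(1)] by auto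
  have \<gamma>: "\<gamma> \<in> range_fibre G (rng G \<mu>)" using assms(2) r by (simp add: range_fibre_def)
  note \<nu> = inverse_translate_in_range_fibre[OF r(2) \<gamma>]
  show thesis
  proof
    show "(\<mu>, comp G (ginv G \<mu>) \<gamma>) \<in> composable_pairs G"
      using range_fibreD[OF \<nu>] r(2) by (simp add: composableI)
    show "\<gamma> = comp G \<mu> (comp G (ginv G \<mu>) \<gamma>)"
      using comp_cancel_ginv_left[OF r(2) \<gamma>] by simp
  qed (use \<mu>(2) in auto)
qed

lemma compactly_supported_convolution:
  assumes "compactly_supported \<phi>" "compactly_supported f"
  shows "compactly_supported (convolution \<phi> f)"
proof -
  obtain C where C: "compactin (arrow_space G) C" "\<And>\<gamma>. \<gamma> \<in> arrows G - C \<Longrightarrow> \<phi> \<gamma> = 0"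
    using assms(1) unfolding compactly_supported_def by blast
  obtain D where D: "compactin (arrow_space G) D" "\<And>\<gamma>. \<gamma> \<in> arrows G - D \<Longrightarrow> f \<gamma> = 0"
    using assms(2) unfolding compactly_supported_def by blast
  have "\<gamma> \<in> (\<lambda>(\<gamma>, \<mu>). comp G \<gamma> \<mu>) ` (C \<times> D \<inter> composable_pairs G)"
    if "\<gamma> \<in> arrows G" "convolution \<phi> f \<gamma> \<noteq> 0" for \<gamma>
  proof -
    from that(2,1)
    obtain \<mu> \<nu> where p: "(\<mu>, \<nu>) \<in> composable_pairs G" "\<phi> \<mu> \<noteq> 0" "f \<nu> \<noteq> 0" "\<gamma> = comp G \<mu> \<nu>"
      by (rule convolution_neq_0D)
    then have "\<mu> \<in> C" "\<nu> \<in> D" using C(2)[of \<mu>] D(2)[of \<nu>] by (auto simp: composable_pairs_def)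
    then show ?thesis using p by force
  qed
  then show ?thesis
    unfolding compactly_supported_def using compactin_product[OF Hausdorff C(1) D(1)] by blast
qed

text \<open>Urysohn's lemma, applied to \<open>E\<close> and the complement of an open set between
  \<open>E\<close> and a compact set \<open>C\<close>.\<close>

lemma obtain_compactly_supported_bump:
  assumes E: "compactin (arrow_space G) E"
  obtains \<phi> :: "'a \<Rightarrow> real" and C where "continuous_map (arrow_space G) euclideanreal \<phi>"
    "compactin (arrow_space G) C" "\<forall>\<gamma>\<in>arrows G - C. \<phi> \<gamma> = 0"
    "\<forall>\<gamma>\<in>arrows G. 0 \<le> \<phi> \<gamma> \<and> \<phi> \<gamma> \<le> 1" "\<forall>\<gamma>\<in>E. \<phi> \<gamma> = 1"
proof -
  obtain U C where U: "openin (arrow_space G) U" "compactin (arrow_space G) C" "E \<subseteq> U" "U \<subseteq> C"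
    using locally_compact E Hausdorff locally_compact_space_compact_closed_compact by metis
  have "completely_regular_space (arrow_space G)"
    using locally_compact Hausdorff locally_compact_Hausdorff_imp_regular_space
      locally_compact_regular_imp_completely_regular_space by blast
  moreover have "closedin (arrow_space G) (arrows G - U)"
    using U(1) by blast
  ultimately obtain \<phi> :: "'a \<Rightarrow> real" where
    \<phi>: "continuous_map (arrow_space G) (top_of_set {0..1}) \<phi>" "\<phi> ` (arrows G - U) \<subseteq> {0}" "\<phi> ` E \<subseteq> {1}"
    using Urysohn_completely_regular_compact_closed[of 0 1 "arrow_space G" E "arrows G - U"] E U(3)
    by (metis DiffE disjnt_iff subsetD zero_le_one)
  show thesis
  proof (rule that[of \<phi> C])
    show "continuous_map (arrow_space G) euclideanreal \<phi>"
      using \<phi>(1) by (simp add: continuous_map_in_subtopology)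
    show "\<forall>\<gamma>\<in>arrows G. 0 \<le> \<phi> \<gamma> \<and> \<phi> \<gamma> \<le> 1"
      using \<phi>(1) by (auto simp: continuous_map_in_subtopology Pi_iff image_subset_iff)
  qed (use U \<phi> in auto)
qed

text \<open>
  Truncating at height \<open>1\<close> after each convolution makes the fibre mass a lower bound for the size of
  the support, so that it grows only polynomially; the masses of the convolution powers themselves
  grow exponentially.
\<close>

primrec truncated_power :: "('a \<Rightarrow> real) \<Rightarrow> nat \<Rightarrow> 'a \<Rightarrow> real" where
  "truncated_power \<phi> 0 = \<phi>"
| "truncated_power \<phi> (Suc k) = (\<lambda>\<gamma>. min 1 (convolution \<phi> (truncated_power \<phi> k) \<gamma>))"

lemma truncated_power_compactly_supported:
  assumes "compactly_supported \<phi>"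
  shows "compactly_supported (truncated_power \<phi> k)"
proof (induction k)
  case (Suc k)
  from compactly_supported_convolution[OF assms this] show ?case
    unfolding compactly_supported_def by fastforce
qed (simp add: assms)

lemma truncated_power_continuous:
  assumes "continuous_map (arrow_space G) euclideanreal \<phi>" "compactly_supported \<phi>"
  shows "continuous_map (arrow_space G) euclideanreal (truncated_power \<phi> k)"
  by (induction k) (simp_all add: assms continuous_convolution continuous_map_real_min)

lemma truncated_power_bounds:
  assumes "\<And>\<gamma>. \<gamma> \<in> arrows G \<Longrightarrow> 0 \<le> \<phi> \<gamma> \<and> \<phi> \<gamma> \<le> 1" "\<gamma> \<in> arrows G"
  shows "0 \<le> truncated_power \<phi> k \<gamma> \<and> truncated_power \<phi> k \<gamma> \<le> 1"
  using assms(2)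
proof (induction k arbitrary: \<gamma>)
  case (Suc k)
  have "0 \<le> convolution \<phi> (truncated_power \<phi> k) \<gamma>"
    unfolding convolution_def
  proof (rule infsum_nonneg)
    fix \<mu> assume \<mu>: "\<mu> \<in> range_fibre G (rng G \<gamma>)"
    then have "comp G (ginv G \<mu>) \<gamma> \<in> arrows G"
      using inverse_translate_in_range_fibre[of \<mu> \<gamma>] range_fibreD[OF \<mu>] Suc.prems
      by (auto simp: range_fibre_def)
    then show "0 \<le> \<phi> \<mu> * truncated_power \<phi> k (comp G (ginv G \<mu>) \<gamma>)"
      using assms(1) Suc.IH range_fibreD[OF \<mu>] by simp
  qed
  then show ?case by simp
qed (simp add: assms)

text \<open>The left side is exactly the term at \<open>\<mu>\<close> in the convolution on the
  right, as \<open>\<phi> \<mu> = 1\<close>, and the other terms are non-negative. The truncation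
  does not spoil the bound because the left side is at most 1. The cases of an arrow, its inverse
  and a unit give all comparisons between neighbouring scales.\<close>

lemma truncated_power_translate_le:
  assumes \<phi>: "\<And>\<gamma>. \<gamma> \<in> arrows G \<Longrightarrow> 0 \<le> \<phi> \<gamma> \<and> \<phi> \<gamma> \<le> 1" "compactly_supported \<phi>"
    and \<mu>: "\<mu> \<in> arrows G" "\<phi> \<mu> = 1" and \<gamma>: "\<gamma> \<in> range_fibre G (rng G \<mu>)"
  shows "truncated_power \<phi> k (comp G (ginv G \<mu>) \<gamma>) \<le> truncated_power \<phi> (Suc k) \<gamma>"
proof -
  let ?f = "\<lambda>\<nu>. \<phi> \<nu> * truncated_power \<phi> k (comp G (ginv G \<nu>) \<gamma>)"
  have r: "rng G \<gamma> = rng G \<mu>" using \<gamma> by (simp add: range_fibre_def)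
  have in_arrows: "comp G (ginv G \<nu>) \<gamma> \<in> arrows G" if "\<nu> \<in> range_fibre G (rng G \<mu>)" for \<nu>
    using inverse_translate_in_range_fibre[of \<nu> \<gamma>] that \<gamma> by (auto simp: range_fibre_def)
  have \<mu>': "\<mu> \<in> range_fibre G (rng G \<mu>)" using \<mu>(1) by (simp add: range_fibre_def)
  have "sum ?f {\<mu>} \<le> infsum ?f (range_fibre G (rng G \<mu>))"
  proof (rule finite_sum_le_infsum)
    show "?f summable_on range_fibre G (rng G \<mu>)"
      by (intro summable_on_range_fibre compactly_supported_mult \<phi>)
    show "0 \<le> ?f \<nu>" if "\<nu> \<in> range_fibre G (rng G \<mu>) - {\<mu>}" for \<nu>
      using that in_arrows[of \<nu>] \<phi>(1)[of \<nu>] truncated_power_bounds[OF \<phi>(1)] range_fibreD[of \<nu>] by auto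
  qed (use \<mu>' in auto)
  then show ?thesis
    using truncated_power_bounds[OF \<phi>(1) in_arrows[OF \<mu>'], where k = k] \<mu>(2) r
    by (simp add: convolution_def)
qed

section \<open>Growth bounds for the fibre mass\<close>

lemma truncated_power_support_length:
  assumes l: "length_function G l"
    and c: "\<And>\<gamma>. \<gamma> \<in> arrows G \<Longrightarrow> \<phi> \<gamma> \<noteq> 0 \<Longrightarrow> l \<gamma> \<le> c"
    and "\<gamma> \<in> arrows G" "truncated_power \<phi> k \<gamma> \<noteq> 0"
  shows "l \<gamma> \<le> c * real (Suc k)"
  using assms(3,4)
proof (induction k arbitrary: \<gamma>)
  case 0
  then show ?case using c by simp
next
  case (Suc k)
  then have "convolution \<phi> (truncated_power \<phi> k) \<gamma> \<noteq> 0" by auto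
  \<comment> \<open>Each convolution adds one factor from the support of \<open>\<phi>\<close>, and
    level 0 already has one; hence \<open>Suc k\<close> in the bound.\<close>
  then obtain \<mu> \<nu> where p: "(\<mu>, \<nu>) \<in> composable_pairs G" "\<phi> \<mu> \<noteq> 0" "truncated_power \<phi> k \<nu> \<noteq> 0" "\<gamma> = comp G \<mu> \<nu>"
    using convolution_neq_0D Suc.prems(1) by metis
  then have "\<mu> \<in> arrows G" "\<nu> \<in> arrows G" by (auto simp: composable_pairs_def)
  then have "l \<mu> \<le> c" "l \<nu> \<le> c * real (Suc k)" using c p Suc.IH by auto
  moreover have "l \<gamma> \<le> l \<mu> + l \<nu>" using l p unfolding length_function_def by auto
  ultimately show ?case by (simp add: algebra_simps)
qed

text \<open>Growth counts arrows with a given source, whereas the masses live on range fibres.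
  Inversion exchanges the two and preserves length.\<close>

lemma range_ball_card_le:
  assumes "length_function G l" "uniformly_fibrewise_proper G l" "0 \<le> t" "x \<in> units G"
  shows "finite {\<gamma> \<in> range_fibre G x. l \<gamma> \<le> t}"
    and "real (card {\<gamma> \<in> range_fibre G x. l \<gamma> \<le> t}) \<le> growth_function G l t"
proof -
  let ?R = "{\<gamma> \<in> range_fibre G x. l \<gamma> \<le> t}"
  have inj: "inj_on (ginv G) ?R"
    by (rule inj_on_inverseI[where g = "ginv G"]) (auto simp: range_fibre_def ginv_ginv)
  have sub: "ginv G ` ?R \<subseteq> fibre_ball G l t x"
    using assms(1) ginv_closed src_ginv
    by (auto simp: fibre_ball_def length_ball_def length_function_def range_fibre_def)
  have fin: "finite (fibre_ball G l t x)"
    and bdd: "bdd_above ((\<lambda>x. card (fibre_ball G l t x)) ` units G)"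
    using assms unfolding uniformly_fibrewise_proper_def by auto
  show "finite ?R" using inj sub fin by (meson finite_imageD finite_subset)
  have "card ?R \<le> card (fibre_ball G l t x)" using inj sub fin by (metis card_image card_mono)
  also have "\<dots> \<le> (SUP x \<in> units G. card (fibre_ball G l t x))" using bdd assms(4) by (rule cSUP_upper2) simp
  finally show "real (card ?R) \<le> growth_function G l t" by (simp add: growth_function_def)
qed

text \<open>The bound \<open>f \<gamma> \<le> 1\<close>, which truncation secures, lets the number
  of points in a ball dominate the mass.\<close>

lemma fibre_mass_le_growth:
  assumes l: "length_function G l" "uniformly_fibrewise_proper G l" and "0 \<le> t" "x \<in> units G"
    and f: "compactly_supported f" "\<And>\<gamma>. \<gamma> \<in> arrows G \<Longrightarrow> f \<gamma> \<le> 1"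
    and supp: "\<And>\<gamma>. \<gamma> \<in> arrows G \<Longrightarrow> f \<gamma> \<noteq> 0 \<Longrightarrow> l \<gamma> \<le> t"
  shows "fibre_mass f x \<le> growth_function G l t"
proof -
  let ?R = "{\<gamma> \<in> range_fibre G x. l \<gamma> \<le> t}"
  note R = range_ball_card_le[OF assms(1-4)]
  have "fibre_mass f x \<le> infsum (\<lambda>_. 1) ?R"
    unfolding fibre_mass_def
  proof (rule infsum_mono_neutral)
    show "f \<gamma> \<le> 0" if "\<gamma> \<in> range_fibre G x - ?R" for \<gamma>
      using that supp[of \<gamma>] by (cases "f \<gamma> = 0") (auto simp: range_fibre_def)
  qed (use R(1) f summable_on_range_fibre in \<open>auto simp: range_fibre_def\<close>)
  also have "\<dots> = real (card ?R)" using R(1) by simp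
  finally show ?thesis using R(2) by simp
qed

lemma controlled_bounded_on_compact:
  assumes "controlled G l" "compactin (arrow_space G) C"
  shows "bdd_above (l ` C)"
proof -
  have "arrow_space G closure_of C = C"
    using assms(2) Hausdorff by (simp add: closure_of_closedin compactin_imp_closedin)
  then show ?thesis
    using assms compactin_subset_topspace unfolding controlled_def by metis
qed


section \<open>Translates of the truncated powers\<close>

lemma ginv_unit:
  assumes "x \<in> units G"
  shows "ginv G x = x"
proof -
  have x: "x \<in> arrows G" using assms by (rule units_arrow)
  have "comp G (ginv G x) x = ginv G x"
    using comp_src_right[OF ginv_closed[OF x]] x assms by (simp add: src_ginv rng_unit)
  then show ?thesis using comp_ginv_left[OF x] assms by (simp add: src_unit)
qed

text \<open>Translation by the unit \<open>x\<close> is the identity on its fibre, so this is the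
  translation inequality at \<open>x\<close>.\<close>

lemma truncated_power_mono:
  assumes "\<And>\<gamma>. \<gamma> \<in> arrows G \<Longrightarrow> 0 \<le> \<phi> \<gamma> \<and> \<phi> \<gamma> \<le> 1" "compactly_supported \<phi>"
    and "x \<in> units G" "\<phi> x = 1" "\<gamma> \<in> range_fibre G x"
  shows "truncated_power \<phi> k \<gamma> \<le> truncated_power \<phi> (Suc k) \<gamma>"
proof -
  have "comp G (ginv G x) \<gamma> = \<gamma>"
    using assms(3,5) comp_rng_left[of \<gamma>] by (simp add: ginv_unit range_fibre_def)
  then show ?thesis
    using truncated_power_translate_le[OF assms(1,2) units_arrow[OF assms(3)] assms(4), of \<gamma> k] assms(3,5)
    by (simp add: rng_unit)
qed

lemma fibre_mass_translate:
  assumes "\<mu> \<in> arrows G"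
  shows "(\<Sum>\<^sub>\<infinity>\<gamma>\<in>range_fibre G (rng G \<mu>). f (comp G (ginv G \<mu>) \<gamma>)) = fibre_mass f (src G \<mu>)"
  unfolding fibre_mass_def by (rule infsum_reindex_bij_betw[OF bij_betw_left_translate[OF assms]])

lemma summable_on_translate:
  assumes "\<mu> \<in> arrows G" "compactly_supported f"
  shows "(\<lambda>\<gamma>. f (comp G (ginv G \<mu>) \<gamma>)) summable_on range_fibre G (rng G \<mu>)"
  using summable_on_range_fibre[OF assms(2)]
  by (subst summable_on_reindex_bij_betw[OF bij_betw_left_translate[OF assms(1)]])

lemma le_fibre_mass:
  assumes "compactly_supported f" "\<And>\<gamma>. \<gamma> \<in> arrows G \<Longrightarrow> 0 \<le> f \<gamma>" "\<gamma> \<in> range_fibre G x"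
  shows "f \<gamma> \<le> fibre_mass f x"
  unfolding fibre_mass_def
  using finite_sum_le_infsum[OF summable_on_range_fibre[OF assms(1)], of "{\<gamma>}" x] assms(2,3)
  by (auto simp: range_fibre_def)

text \<open>The estimate for normalised functions is applied with the truncated power at level
  \<open>k\<close> as lower function. The mass at level \<open>k + 2\<close> over
  \<open>rng G \<mu>\<close> bounds both masses at level \<open>Suc k\<close>: that of the function
  itself by monotonicity, and that of its translate by the translation inequality.\<close>

lemma truncated_power_translate_distance:
  assumes \<phi>: "\<And>\<gamma>. \<gamma> \<in> arrows G \<Longrightarrow> 0 \<le> \<phi> \<gamma> \<and> \<phi> \<gamma> \<le> 1" "compactly_supported \<phi>"
    and \<mu>: "\<mu> \<in> arrows G"
    and one: "\<phi> \<mu> = 1" "\<phi> (ginv G \<mu>) = 1" "\<phi> (rng G \<mu>) = 1"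
    and m: "m = (\<lambda>k. fibre_mass (truncated_power \<phi> k))"
    and pos: "0 < m (Suc k) (rng G \<mu>)" "0 < m (Suc k) (src G \<mu>)"
  shows "(\<Sum>\<^sub>\<infinity>\<gamma>\<in>range_fibre G (rng G \<mu>).
      \<bar>truncated_power \<phi> (Suc k) (comp G (ginv G \<mu>) \<gamma>) / m (Suc k) (src G \<mu>) -
       truncated_power \<phi> (Suc k) \<gamma> / m (Suc k) (rng G \<mu>)\<bar>)
    \<le> 2 * (1 - m k (rng G \<mu>) / m (k + 2) (rng G \<mu>))"
proof -
  let ?f = "truncated_power \<phi>"
  let ?S = "range_fibre G (rng G \<mu>)"
  define u where "u = ?f (Suc k)"
  define v where "v = (\<lambda>\<gamma>. ?f (Suc k) (comp G (ginv G \<mu>) \<gamma>))"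
  have x: "rng G \<mu> \<in> units G" using \<mu> rng_closed by blast
  have cs: "compactly_supported (?f j)" for j
    using \<phi>(2) by (rule truncated_power_compactly_supported)
  have mono: "?f j \<gamma> \<le> ?f (Suc j) \<gamma>" if "\<gamma> \<in> ?S" for j \<gamma>
    using truncated_power_mono[OF \<phi> x one(3) that] .
  have up: "?f j (comp G (ginv G \<mu>) \<gamma>) \<le> ?f (Suc j) \<gamma>" if "\<gamma> \<in> ?S" for j \<gamma>
    using truncated_power_translate_le[OF \<phi> \<mu> one(1) that] .
  \<comment> \<open>This is the translation inequality for the inverse of \<open>\<mu>\<close>,
    followed by cancellation.\<close>
  have down: "?f j \<gamma> \<le> ?f (Suc j) (comp G (ginv G \<mu>) \<gamma>)" if "\<gamma> \<in> ?S" for j \<gamma>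
  proof -
    have "comp G (ginv G \<mu>) \<gamma> \<in> range_fibre G (rng G (ginv G \<mu>))"
      using inverse_translate_in_range_fibre[OF \<mu> that] \<mu> by (simp add: rng_ginv)
    from truncated_power_translate_le[OF \<phi> ginv_closed[OF \<mu>] one(2) this, of j]
    show ?thesis using comp_cancel_ginv_left[OF \<mu> that] by (simp add: ginv_ginv[OF \<mu>] del: truncated_power.simps)
  qed
  have U: "infsum u ?S = m (Suc k) (rng G \<mu>)"
    by (simp add: u_def m fibre_mass_def del: truncated_power.simps)
  have V: "infsum v ?S = m (Suc k) (src G \<mu>)"
    unfolding v_def m by (rule fibre_mass_translate[OF \<mu>])
  have summ: "u summable_on ?S" "v summable_on ?S" "?f k summable_on ?S"
    unfolding u_def v_def using cs \<mu> by (intro summable_on_range_fibre summable_on_translate; blast)+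
  have M: "m (k + 2) (rng G \<mu>) = infsum (?f (Suc (Suc k))) ?S"
    by (simp add: m fibre_mass_def del: truncated_power.simps)
  have le: "infsum u ?S \<le> m (k + 2) (rng G \<mu>)" "infsum v ?S \<le> m (k + 2) (rng G \<mu>)"
    unfolding M using summ summable_on_range_fibre[OF cs] mono up
    by (auto intro!: infsum_mono simp: u_def v_def simp del: truncated_power.simps)
  have "(\<Sum>\<^sub>\<infinity>\<gamma>\<in>?S. \<bar>v \<gamma> / infsum v ?S - u \<gamma> / infsum u ?S\<bar>)
      \<le> 2 * (1 - infsum (?f k) ?S / m (k + 2) (rng G \<mu>))"
  proof (rule infsum_abs_diff_normalised_le[OF summ])
    show "0 \<le> ?f k \<gamma>" if "\<gamma> \<in> ?S" for \<gamma>
      using truncated_power_bounds[OF \<phi>(1)] that by (simp add: range_fibre_def)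
    show "?f k \<gamma> \<le> u \<gamma>" "?f k \<gamma> \<le> v \<gamma>" if "\<gamma> \<in> ?S" for \<gamma>
      unfolding u_def v_def using mono[OF that] down[OF that] by auto
    show "0 < infsum u ?S" "0 < infsum v ?S"
      using pos by (simp_all add: U V)
  qed (use le in auto)
  then show ?thesis
    unfolding U V by (simp add: u_def v_def m fibre_mass_def del: truncated_power.simps)
qed

section \<open>Averaging the normalised functions over the scales\<close>

lemma almost_invariant_density:
  assumes growth: "polynomial_growth G"
    and L: "compactin (arrow_space G) L" and \<epsilon>: "0 < \<epsilon>"
  obtains g :: "'a \<Rightarrow> real" where "continuous_map (arrow_space G) euclideanreal g"
    "\<And>\<gamma>. \<gamma> \<in> arrows G \<Longrightarrow> 0 \<le> g \<gamma>"
    "\<And>x. x \<in> units G \<Longrightarrow> g summable_on range_fibre G x"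
    "\<And>x. x \<in> units G \<Longrightarrow> (\<Sum>\<^sub>\<infinity>\<gamma>\<in>range_fibre G x. g \<gamma>) \<le> 1"
    "\<And>x. x \<in> units G \<Longrightarrow> x \<in> L \<Longrightarrow> (\<Sum>\<^sub>\<infinity>\<gamma>\<in>range_fibre G x. g \<gamma>) = 1"
    "\<And>\<mu>. \<mu> \<in> L \<Longrightarrow> (\<Sum>\<^sub>\<infinity>\<gamma>\<in>range_fibre G (rng G \<mu>). \<bar>g (comp G (ginv G \<mu>) \<gamma>) - g \<gamma>\<bar>) \<le> \<epsilon>"
proof -
  obtain l and p :: "real poly" where l: "length_function G l" "controlled G l" "uniformly_fibrewise_proper G l"
    and p: "\<And>t. 0 \<le> t \<Longrightarrow> growth_function G l t \<le> poly p t"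
    using growth unfolding polynomial_growth_def uniformly_fibrewise_coarse_def by blast
  have LX: "L \<subseteq> arrows G" using L by (rule compactin_subset_topspace)
  \<comment> \<open>The value 1 on \<open>L\<close> and on its inverse gives the two translation
    inequalities, on ranges monotonicity; on ranges and sources it keeps the masses at least
    1.\<close>
  define E where "E = L \<union> ginv G ` L \<union> rng G ` L \<union> src G ` L"
  have "compactin (arrow_space G) E"
    unfolding E_def
    by (intro compactin_Un image_compactin[OF L] L continuous_ginv continuous_rng continuous_src)
  then obtain \<phi> C where \<phi>c: "continuous_map (arrow_space G) euclideanreal \<phi>"
    and C: "compactin (arrow_space G) C" "\<forall>\<gamma>\<in>arrows G - C. \<phi> \<gamma> = 0"
    and bds: "\<forall>\<gamma>\<in>arrows G. 0 \<le> \<phi> \<gamma> \<and> \<phi> \<gamma> \<le> 1" "\<forall>\<gamma>\<in>E. \<phi> \<gamma> = 1"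
    using obtain_compactly_supported_bump by blast
  have \<phi>: "0 \<le> \<phi> \<gamma> \<and> \<phi> \<gamma> \<le> 1" if "\<gamma> \<in> arrows G" for \<gamma> using bds that by blast
  have \<phi>1: "\<phi> \<gamma> = 1" if "\<gamma> \<in> E" for \<gamma> using bds that by blast
  have \<phi>s: "compactly_supported \<phi>" using C unfolding compactly_supported_def by blast
  obtain c0 where "\<And>\<gamma>. \<gamma> \<in> C \<Longrightarrow> l \<gamma> \<le> c0"
    using controlled_bounded_on_compact[OF l(2) C(1)] unfolding bdd_above_def by auto
  then have l_le: "l \<gamma> \<le> max 1 c0" if "\<gamma> \<in> arrows G" "\<phi> \<gamma> \<noteq> 0" for \<gamma>
    using that C(2) by (cases "\<gamma> \<in> C") (auto simp: le_max_iff_disj)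
  define c where "c = max 1 c0"
  have c1: "1 \<le> c" by (simp add: c_def)
  \<comment> \<open>The defect will be at most \<open>4 * ln B / n\<close>, hence
    \<open>\<epsilon> / 4\<close>. The highest level needed is \<open>Suc n\<close>, whose support
    has length at most \<open>c * real (n + 2)\<close>.\<close>
  obtain n B where n: "0 < n" "ln B \<le> \<epsilon> / 4 * real n" "poly p (c * real (n + 2)) \<le> B" "1 \<le> B"
    using polynomial_imp_log_average_small[OF c1, of "\<epsilon> / 4"] \<epsilon> by auto
  define f where "f = truncated_power \<phi>"
  define m where "m = (\<lambda>k. fibre_mass (f k))"
  have fs: "compactly_supported (f k)" for k
    unfolding f_def using \<phi>s by (rule truncated_power_compactly_supported)
  have fc: "continuous_map (arrow_space G) euclideanreal (f k)" for k
    unfolding f_def using \<phi>c \<phi>s by (rule truncated_power_continuous)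
  have fb: "0 \<le> f k \<gamma>" "f k \<gamma> \<le> 1" if "\<gamma> \<in> arrows G" for k \<gamma>
    using truncated_power_bounds[OF \<phi> that] by (auto simp: f_def)
  have f1: "f k x = 1" if "x \<in> units G" "x \<in> E" for k x
  proof (induction k)
    case 0
    then show ?case using \<phi>1[OF that(2)] by (simp add: f_def)
  next
    case (Suc k)
    have "f k x \<le> f (Suc k) x"
      unfolding f_def using truncated_power_mono[OF \<phi> \<phi>s that(1) \<phi>1[OF that(2)] unit_in_range_fibre[OF that(1)]] .
    then show ?case using Suc fb(2)[OF units_arrow[OF that(1)]] by (simp add: antisym)
  qed
  have m1: "1 \<le> m k x" if "x \<in> units G" "x \<in> E" for k x
    using le_fibre_mass[OF fs fb(1) unit_in_range_fibre[OF that(1)], of k] f1[OF that] by (simp add: m_def)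
  have m0: "0 \<le> m k x" if "x \<in> units G" for k x
    unfolding m_def fibre_mass_def using fb(1) range_fibreD(1) by (intro infsum_nonneg) blast
  have mB: "m k x \<le> B" if "x \<in> units G" "k \<le> Suc n" for k x
  proof -
    have "m k x \<le> growth_function G l (c * real (n + 2))"
      unfolding m_def
    proof (rule fibre_mass_le_growth[OF l(1,3) _ that(1) fs fb(2)])
      fix \<gamma> assume "\<gamma> \<in> arrows G" "f k \<gamma> \<noteq> 0"
      then have "l \<gamma> \<le> c * real (Suc k)"
        using truncated_power_support_length[OF l(1), of \<phi> c \<gamma> k] l_le by (simp add: f_def c_def)
      also have "\<dots> \<le> c * real (n + 2)" using c1 that(2) by (intro mult_left_mono) auto
      finally show "l \<gamma> \<le> c * real (n + 2)" .
    qed (use c1 in auto)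
    also have "\<dots> \<le> B" using p[of "c * real (n + 2)"] n(3) c1 by auto
    finally show ?thesis .
  qed
  \<comment> \<open>The maximum with 1 keeps the denominator continuous and positive on all fibres.
    Over units in \<open>E\<close> it is the mass itself, so the normalisation is exact there;
    elsewhere the total stays at most 1.\<close>
  define w where "w = (\<lambda>k x. max 1 (m (Suc k) x))"
  define g where "g = (\<lambda>\<gamma>. (\<Sum>k<n. f (Suc k) \<gamma> / w k (rng G \<gamma>)) / real n)"
  have g_sum: "(g has_sum ((\<Sum>k<n. m (Suc k) x / w k x) / real n)) (range_fibre G x)" for x
  proof -
    have "((\<lambda>\<gamma>. (\<Sum>k<n. f (Suc k) \<gamma> / w k x) / real n) has_sum ((\<Sum>k<n. m (Suc k) x / w k x) / real n))
        (range_fibre G x)"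
      unfolding divide_inverse m_def fibre_mass_def
      by (intro has_sum_cmult_left has_sum_finite_sum) (simp_all add: summable_on_range_fibre fs)
    then show ?thesis
      by (rule has_sum_cong[THEN iffD1, rotated]) (simp add: g_def range_fibre_def)
  qed
  note g_inf = infsumI[OF g_sum]
  show thesis
  proof
    show "continuous_map (arrow_space G) euclideanreal g"
      unfolding g_def w_def m_def
      by (intro continuous_map_real_divide continuous_map_sum continuous_map_real_max
          continuous_fibre_mass fc fs) (use n(1) in auto)
    show "0 \<le> g \<gamma>" if "\<gamma> \<in> arrows G" for \<gamma>
      unfolding g_def w_def using fb(1)[OF that] by (intro divide_nonneg_nonneg sum_nonneg) auto
    show "g summable_on range_fibre G x" for x
      using g_sum has_sum_imp_summable by blast
    show "(\<Sum>\<^sub>\<infinity>\<gamma>\<in>range_fibre G x. g \<gamma>) \<le> 1" for x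
    proof -
      have "m (Suc k) x / w k x \<le> 1" for k
        by (simp add: w_def divide_le_eq)
      then have "(\<Sum>k<n. m (Suc k) x / w k x) \<le> real n"
        using sum_bounded_above[of "{..<n}" "\<lambda>k. m (Suc k) x / w k x" 1] by simp
      then show ?thesis unfolding g_inf using n(1) by simp
    qed
    show "(\<Sum>\<^sub>\<infinity>\<gamma>\<in>range_fibre G x. g \<gamma>) = 1" if "x \<in> units G" "x \<in> L" for x
    proof -
      have "m (Suc k) x / w k x = 1" for k
        using m1[OF that(1), of "Suc k"] that(2) by (simp add: w_def E_def max_def)
      then have "(\<Sum>k<n. m (Suc k) x / w k x) = (\<Sum>k<n. 1)"
        by (rule sum.cong[OF refl])
      then show ?thesis unfolding g_inf using n(1) by simp
    qed
    show "(\<Sum>\<^sub>\<infinity>\<gamma>\<in>range_fibre G (rng G \<mu>). \<bar>g (comp G (ginv G \<mu>) \<gamma>) - g \<gamma>\<bar>) \<le> \<epsilon>" if "\<mu> \<in> L" for \<mu>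
    proof -
      have \<mu>: "\<mu> \<in> arrows G" using that LX by blast
      define x y S where "x = rng G \<mu>" and "y = src G \<mu>" and "S = range_fibre G (rng G \<mu>)"
      have xy: "x \<in> units G" "y \<in> units G" "x \<in> E" "y \<in> E"
        using \<mu> that rng_closed src_closed by (auto simp: x_def y_def E_def)
      have w: "w k x = m (Suc k) x" "w k y = m (Suc k) y" for k
        using m1[OF xy(1,3), of "Suc k"] m1[OF xy(2,4), of "Suc k"] by (simp_all add: w_def)
      define d where "d = (\<lambda>k \<gamma>. \<bar>f (Suc k) (comp G (ginv G \<mu>) \<gamma>) / m (Suc k) y - f (Suc k) \<gamma> / m (Suc k) x\<bar>)"
      have sd: "d k summable_on S" for k
      proof -
        have "(\<lambda>\<gamma>. f (Suc k) (comp G (ginv G \<mu>) \<gamma>) / m (Suc k) y + f (Suc k) \<gamma> / m (Suc k) x) summable_on S"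
          unfolding divide_inverse S_def
          by (intro summable_on_add summable_on_cmult_left summable_on_translate summable_on_range_fibre fs \<mu>)
        then show ?thesis
        proof (rule summable_on_comparison_test)
          fix \<gamma> assume "\<gamma> \<in> S"
          then have "0 \<le> f (Suc k) (comp G (ginv G \<mu>) \<gamma>)" "0 \<le> f (Suc k) \<gamma>"
            using fb(1) inverse_translate_in_range_fibre[OF \<mu>] range_fibreD(1) unfolding S_def by blast+
          then have "0 \<le> f (Suc k) (comp G (ginv G \<mu>) \<gamma>) / m (Suc k) y" "0 \<le> f (Suc k) \<gamma> / m (Suc k) x"
            using m0 xy by auto
          then show "d k \<gamma> \<le> f (Suc k) (comp G (ginv G \<mu>) \<gamma>) / m (Suc k) y + f (Suc k) \<gamma> / m (Suc k) x"
            unfolding d_def by linarith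
        qed (simp add: d_def)
      qed
      have d_le: "infsum (d k) S \<le> 2 * (1 - m k x / m (k + 2) x)" for k
        unfolding d_def S_def x_def y_def f_def
      proof (rule truncated_power_translate_distance[OF \<phi> \<phi>s \<mu>])
        show "m = (\<lambda>k. fibre_mass (truncated_power \<phi> k))" by (simp add: m_def f_def)
        show "0 < m (Suc k) (rng G \<mu>)" "0 < m (Suc k) (src G \<mu>)"
          using m1[OF xy(1,3), of "Suc k"] m1[OF xy(2,4), of "Suc k"] by (simp_all add: x_def y_def)
      qed (use \<phi>1 that in \<open>auto simp: E_def\<close>)
      have hs: "((\<lambda>\<gamma>. (\<Sum>k<n. d k \<gamma>) * inverse (real n)) has_sum ((\<Sum>k<n. infsum (d k) S) * inverse (real n))) S"
        using sd by (intro has_sum_cmult_left has_sum_finite_sum) auto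
      \<comment> \<open>The translated arrow has range \<open>y\<close>, so the first term carries
        the weights at \<open>y\<close>. Both \<open>x\<close> and \<open>y\<close> lie in
        \<open>E\<close>, where the weights are the masses.\<close>
      have ptwise: "\<bar>g (comp G (ginv G \<mu>) \<gamma>) - g \<gamma>\<bar> \<le> (\<Sum>k<n. d k \<gamma>) * inverse (real n)" if "\<gamma> \<in> S" for \<gamma>
      proof -
        have "rng G \<gamma> = x" "rng G (comp G (ginv G \<mu>) \<gamma>) = y"
          using that inverse_translate_in_range_fibre[OF \<mu>] by (auto simp: S_def x_def y_def range_fibre_def)
        then have "g (comp G (ginv G \<mu>) \<gamma>) - g \<gamma> = (\<Sum>k<n. f (Suc k) (comp G (ginv G \<mu>) \<gamma>) / m (Suc k) y
            - f (Suc k) \<gamma> / m (Suc k) x) * inverse (real n)"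
          by (simp add: g_def w sum_subtractf divide_inverse left_diff_distrib)
        then show ?thesis
          by (simp add: abs_mult d_def sum_abs mult_right_mono)
      qed
      have "(\<lambda>\<gamma>. \<bar>g (comp G (ginv G \<mu>) \<gamma>) - g \<gamma>\<bar>) summable_on S"
        by (rule summable_on_comparison_test[OF has_sum_imp_summable[OF hs]]) (use ptwise in auto)
      then have "(\<Sum>\<^sub>\<infinity>\<gamma>\<in>S. \<bar>g (comp G (ginv G \<mu>) \<gamma>) - g \<gamma>\<bar>)
          \<le> (\<Sum>\<^sub>\<infinity>\<gamma>\<in>S. (\<Sum>k<n. d k \<gamma>) * inverse (real n))"
        using has_sum_imp_summable[OF hs] ptwise by (rule infsum_mono)
      also have "\<dots> = (\<Sum>k<n. infsum (d k) S) * inverse (real n)"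
        by (rule infsumI[OF hs])
      also have "\<dots> \<le> (\<Sum>k<n. 2 * (1 - m k x / m (k + 2) x)) * inverse (real n)"
        using d_le by (intro mult_right_mono sum_mono) auto
      also have "\<dots> = 2 * (\<Sum>k<n. 1 - m k x / m (k + 2) x) * inverse (real n)"
        by (simp add: sum_distrib_left)
      \<comment> \<open>The masses at the single unit \<open>x\<close> form the sequence to be
        telescoped; neither \<open>B\<close> nor \<open>n\<close> depends on
        \<open>x\<close>.\<close>
      also have "\<dots> \<le> 2 * (2 * ln B) * inverse (real n)"
        using sum_relative_increments_le[of "\<lambda>k. m k x" n B] m1[OF xy(1,3)] mB[OF xy(1)]
        by (intro mult_right_mono mult_left_mono) auto
      also have "\<dots> \<le> \<epsilon>"
        using n(1,2) by (simp add: field_simps)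
      finally show ?thesis by (simp add: S_def)
    qed
  qed
qed

text \<open>The n-th density is taken for \<open>K n\<close> with tolerance
  \<open>\<epsilon> n\<close>. A compact set lies in \<open>K n\<close> for all large
  \<open>n\<close>, and from then on the mass over its units is exactly 1 and the defect on it is at
  most \<open>\<epsilon> n\<close>.\<close>

lemma second_countable_polynomial_growth_amenable:
  assumes "second_countable (arrow_space G)" "polynomial_growth G"
  shows "topologically_amenable G"
proof -
  obtain K where K: "\<And>n. compactin (arrow_space G) (K n)"
    and Kev: "\<And>C. compactin (arrow_space G) C \<Longrightarrow> \<forall>\<^sub>F n in sequentially. C \<subseteq> K n"
    using compact_exhaustion[OF assms(1) locally_compact Hausdorff] by blast
  define \<epsilon> where "\<epsilon> = (\<lambda>n. inverse (real (Suc n)))"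
  have \<epsilon>: "\<epsilon> \<longlonglongrightarrow> 0" unfolding \<epsilon>_def by (rule LIMSEQ_inverse_real_of_nat)
  have "\<exists>g :: 'a \<Rightarrow> real. continuous_map (arrow_space G) euclideanreal g \<and>
      (\<forall>\<gamma>\<in>arrows G. 0 \<le> g \<gamma>) \<and>
      (\<forall>x\<in>units G. g summable_on range_fibre G x \<and> (\<Sum>\<^sub>\<infinity>\<gamma>\<in>range_fibre G x. g \<gamma>) \<le> 1) \<and>
      (\<forall>x\<in>units G \<inter> K n. (\<Sum>\<^sub>\<infinity>\<gamma>\<in>range_fibre G x. g \<gamma>) = 1) \<and>
      (\<forall>\<mu>\<in>K n. (\<Sum>\<^sub>\<infinity>\<gamma>\<in>range_fibre G (rng G \<mu>). \<bar>g (comp G (ginv G \<mu>) \<gamma>) - g \<gamma>\<bar>) \<le> \<epsilon> n)" for n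
  proof -
    have "0 < \<epsilon> n" by (simp add: \<epsilon>_def)
    from almost_invariant_density[OF assms(2) K[of n] this] obtain g :: "'a \<Rightarrow> real" where
      "continuous_map (arrow_space G) euclideanreal g"
      "\<And>\<gamma>. \<gamma> \<in> arrows G \<Longrightarrow> 0 \<le> g \<gamma>"
      "\<And>x. x \<in> units G \<Longrightarrow> g summable_on range_fibre G x"
      "\<And>x. x \<in> units G \<Longrightarrow> (\<Sum>\<^sub>\<infinity>\<gamma>\<in>range_fibre G x. g \<gamma>) \<le> 1"
      "\<And>x. x \<in> units G \<Longrightarrow> x \<in> K n \<Longrightarrow> (\<Sum>\<^sub>\<infinity>\<gamma>\<in>range_fibre G x. g \<gamma>) = 1"
      "\<And>\<mu>. \<mu> \<in> K n \<Longrightarrow>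
        (\<Sum>\<^sub>\<infinity>\<gamma>\<in>range_fibre G (rng G \<mu>). \<bar>g (comp G (ginv G \<mu>) \<gamma>) - g \<gamma>\<bar>) \<le> \<epsilon> n"
      by blast
    then show ?thesis by (intro exI[of _ g]) auto
  qed
  then obtain g :: "nat \<Rightarrow> 'a \<Rightarrow> real" where g:
    "\<And>n. continuous_map (arrow_space G) euclideanreal (g n) \<and>
      (\<forall>\<gamma>\<in>arrows G. 0 \<le> g n \<gamma>) \<and>
      (\<forall>x\<in>units G. g n summable_on range_fibre G x \<and> (\<Sum>\<^sub>\<infinity>\<gamma>\<in>range_fibre G x. g n \<gamma>) \<le> 1) \<and>
      (\<forall>x\<in>units G \<inter> K n. (\<Sum>\<^sub>\<infinity>\<gamma>\<in>range_fibre G x. g n \<gamma>) = 1) \<and>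
      (\<forall>\<mu>\<in>K n. (\<Sum>\<^sub>\<infinity>\<gamma>\<in>range_fibre G (rng G \<mu>). \<bar>g n (comp G (ginv G \<mu>) \<gamma>) - g n \<gamma>\<bar>) \<le> \<epsilon> n)"
    using choice[of "\<lambda>n g. continuous_map (arrow_space G) euclideanreal g \<and>
      (\<forall>\<gamma>\<in>arrows G. 0 \<le> g \<gamma>) \<and>
      (\<forall>x\<in>units G. g summable_on range_fibre G x \<and> (\<Sum>\<^sub>\<infinity>\<gamma>\<in>range_fibre G x. g \<gamma>) \<le> 1) \<and>
      (\<forall>x\<in>units G \<inter> K n. (\<Sum>\<^sub>\<infinity>\<gamma>\<in>range_fibre G x. g \<gamma>) = 1) \<and>
      (\<forall>\<mu>\<in>K n. (\<Sum>\<^sub>\<infinity>\<gamma>\<in>range_fibre G (rng G \<mu>). \<bar>g (comp G (ginv G \<mu>) \<gamma>) - g \<gamma>\<bar>) \<le> \<epsilon> n)"]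
    by blast
  show ?thesis
    unfolding topologically_amenable_def
  proof (intro exI[of _ g] conjI allI impI ballI)
    fix C assume "compactin (unit_space G) C"
    then have C: "compactin (arrow_space G) C" "C \<subseteq> units G"
      by (auto simp: unit_space_def compactin_subtopology)
    show "uniform_limit C (\<lambda>n x. \<Sum>\<^sub>\<infinity>\<gamma>\<in>range_fibre G x. g n \<gamma>) (\<lambda>x. 1) sequentially"
    proof (rule uniform_limitI)
      fix e :: real assume "0 < e"
      show "\<forall>\<^sub>F n in sequentially. \<forall>x\<in>C. dist (\<Sum>\<^sub>\<infinity>\<gamma>\<in>range_fibre G x. g n \<gamma>) 1 < e"
        using Kev[OF C(1)]
      proof eventually_elim
        case (elim n)
        then show ?case using g[of n] C(2) \<open>0 < e\<close> by (auto simp: subset_iff)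
      qed
    qed
  next
    fix C assume C: "compactin (arrow_space G) C"
    show "uniform_limit C
        (\<lambda>n \<mu>. \<Sum>\<^sub>\<infinity>\<gamma>\<in>range_fibre G (rng G \<mu>). \<bar>g n (comp G (ginv G \<mu>) \<gamma>) - g n \<gamma>\<bar>) (\<lambda>\<mu>. 0) sequentially"
    proof (rule uniform_limitI)
      fix e :: real assume "0 < e"
      then have "\<forall>\<^sub>F n in sequentially. \<epsilon> n < e"
        using \<epsilon> by (intro order_tendstoD(2))
      then show "\<forall>\<^sub>F n in sequentially. \<forall>\<mu>\<in>C.
          dist (\<Sum>\<^sub>\<infinity>\<gamma>\<in>range_fibre G (rng G \<mu>). \<bar>g n (comp G (ginv G \<mu>) \<gamma>) - g n \<gamma>\<bar>) 0 < e"
        using Kev[OF C]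
      proof eventually_elim
        case (elim n)
        show ?case
        proof
          fix \<mu> assume "\<mu> \<in> C"
          then have "(\<Sum>\<^sub>\<infinity>\<gamma>\<in>range_fibre G (rng G \<mu>). \<bar>g n (comp G (ginv G \<mu>) \<gamma>) - g n \<gamma>\<bar>) \<le> \<epsilon> n"
            using g[of n] elim(2) by blast
          also note elim(1)
          finally have "(\<Sum>\<^sub>\<infinity>\<gamma>\<in>range_fibre G (rng G \<mu>). \<bar>g n (comp G (ginv G \<mu>) \<gamma>) - g n \<gamma>\<bar>) < e" .
          then show "dist (\<Sum>\<^sub>\<infinity>\<gamma>\<in>range_fibre G (rng G \<mu>). \<bar>g n (comp G (ginv G \<mu>) \<gamma>) - g n \<gamma>\<bar>) 0 < e"
            by (simp add: infsum_nonneg)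
        qed
      qed
    qed
  qed (use g in auto)
qed

end

theorem theorem1:
  fixes G :: "'a groupoid"
  assumes "lch_etale_groupoid G"
    and "second_countable (arrow_space G)"
    and "polynomial_growth G"
  shows "topologically_amenable G"
  using lch_etale_groupoid.second_countable_polynomial_growth_amenable[OF assms] .

end
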